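(* Let $0<\alpha<1$ and $(k,i)\in\{(1,1),(2,1),(2,2)\}$. Then the method is $A(\frac{\pi}{2})$-stable, i.e. the sector $\{z\in\mathbb{C}:\ z\neq 0,\ |\arg(-z)|\le \frac{\pi}{2}\}$ is contained in the stability region $S^{(k,i)}$ defined in the context.
   Context: Uniform grid $t_n=n\Delta t$, $\Delta t>0$, $I_j=[t_{j-1},t_j]$. For a function $u$ and integers $m\ge1$, $j$, $q$, let $p^{m}_{j,q}$ be the polynomial of degree at most $m$ interpolating $u$ at $t_{j+q-m-1},\dots,t_{j+q-1}$. For $1\le i\le k$ and $n\ge k$, let $P^{k}_{i,n}$ be the continuous piecewise polynomial on $[0,t_n]$ equal on $I_j$ to $p^{k-1}_{j,k-j}$ for $1\le j\le k-i$, to $p^{k}_{j,i}$ for $k-i+1\le j\le n-i+1$, and to $p^{k}_{j,n+1-j}$ for $n-i+2\le j\le n$, and set $D^{\alpha}_{k,i}u_n=\frac{1}{\Gamma(1-\alpha)}\int_0^{t_n}(t_n-\xi)^{-\alpha}(P^{k}_{i,n})'(\xi)\,\mathrm{d}\xi$. This is a linear combination of $u_0,\dots,u_n$ ($u_j=u(t_j)$); for $k\le j\le n$ the coefficient of $u_j$ in $(\Delta t)^{\alpha}D^{\alpha}_{k,i}u_n$ depends only on $n-j$ and is denoted $\omega^{(k,i)}_{n-j}$ (defining $\omega^{(k,i)}_m$ for all $m\ge0$), and $w^{(k,i)}_{n,j}$ ($0\le j\le k-1$) are defined by $(\Delta t)^{\alpha}D^{\alpha}_{k,i}u_n=\sum_{j=0}^{k-1}w^{(k,i)}_{n,j}u_j+\sum_{j=0}^{n}\omega^{(k,i)}_{n-j}u_j$.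 With $z=\lambda(\Delta t)^{\alpha}$, the stability region $S^{(k,i)}$ is the set of $z\in\mathbb{C}$ such that for every choice of bounded starting values $u_0,\dots,u_{k-1}$ the recursion $\sum_{j=0}^{k-1}w^{(k,i)}_{n,j}u_j+\sum_{j=0}^{n}\omega^{(k,i)}_{n-j}u_j=z u_n$ ($n\ge k$) determines $(u_n)_{n\ge k}$ and $u_n\to0$. Here $\arg$ takes values in $[-\pi,\pi]$. *)

theory Defs
  imports "HOL-Analysis.Analysis"
begin

text \<open>Uniform grid t_n = n * dt. Grid values of u are given as a sequence u :: nat => complex.
  lagr dt u a m is the polynomial of degree at most m interpolating the grid values
  at t_a, ..., t_(a+m) (Lagrange form).\<close>
definition lagr :: "real \<Rightarrow> (nat \<Rightarrow> complex) \<Rightarrow> int \<Rightarrow> nat \<Rightarrow> real \<Rightarrow> complex" where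
  "lagr dt u a m t =
     (\<Sum>l\<le>m. u (nat (a + int l)) *
        (\<Prod>r\<in>{..m} - {l}. complex_of_real
            ((t - real_of_int (a + int r) * dt) / ((real l - real r) * dt))))"

definition interp :: "real \<Rightarrow> (nat \<Rightarrow> complex) \<Rightarrow> nat \<Rightarrow> int \<Rightarrow> int \<Rightarrow> real \<Rightarrow> complex" where
  "interp dt u m j q = lagr dt u (j + q - int m - 1) m"

definition piece :: "real \<Rightarrow> (nat \<Rightarrow> complex) \<Rightarrow> nat \<Rightarrow> nat \<Rightarrow> nat \<Rightarrow> nat \<Rightarrow> real \<Rightarrow> complex" where
  "piece dt u k i n j =
     (if int j \<le> int k - int i then interp dt u (k - 1) (int j) (int k - int j)
      else if int j \<le> int n - int i + 1 then interp dt u k (int j) (int i)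
      else interp dt u k (int j) (int n + 1 - int j))"

text \<open>P^k_{i,n} as a function on [0, t_n]: on I_j = [t_{j-1}, t_j] it equals piece j.\<close>
definition PP :: "real \<Rightarrow> (nat \<Rightarrow> complex) \<Rightarrow> nat \<Rightarrow> nat \<Rightarrow> nat \<Rightarrow> real \<Rightarrow> complex" where
  "PP dt u k i n \<xi> = piece dt u k i n (max 1 (nat \<lceil>\<xi> / dt\<rceil>)) \<xi>"

definition fracD :: "real \<Rightarrow> real \<Rightarrow> nat \<Rightarrow> nat \<Rightarrow> (nat \<Rightarrow> complex) \<Rightarrow> nat \<Rightarrow> complex" where
  "fracD dt \<alpha> k i u n =
     complex_of_real (1 / Gamma (1 - \<alpha>)) *
     integral {0 .. real n * dt}
       (\<lambda>\<xi>. complex_of_real ((real n * dt - \<xi>) powr (- \<alpha>)) *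
             vector_derivative (PP dt u k i n) (at \<xi>))"

text \<open>Coefficient of u_j in (dt)^alpha D^alpha_{k,i} u_n (apply the linear functional to the j-th unit sequence).\<close>
definition coef :: "real \<Rightarrow> real \<Rightarrow> nat \<Rightarrow> nat \<Rightarrow> nat \<Rightarrow> nat \<Rightarrow> complex" where
  "coef dt \<alpha> k i n j = complex_of_real (dt powr \<alpha>) * fracD dt \<alpha> k i (\<lambda>l. if l = j then 1 else 0) n"

text \<open>omega^{(k,i)}_m := coefficient of u_j with j = k, n = m + k (so n - j = m, k <= j <= n).\<close>
definition omega :: "real \<Rightarrow> real \<Rightarrow> nat \<Rightarrow> nat \<Rightarrow> nat \<Rightarrow> complex" where
  "omega dt \<alpha> k i m = coef dt \<alpha> k i (m + k) k"

definition wst :: "real \<Rightarrow> real \<Rightarrow> nat \<Rightarrow> nat \<Rightarrow> nat \<Rightarrow> nat \<Rightarrow> complex" where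
  "wst dt \<alpha> k i n j = coef dt \<alpha> k i n j - omega dt \<alpha> k i (n - j)"

definition solves :: "real \<Rightarrow> real \<Rightarrow> nat \<Rightarrow> nat \<Rightarrow> complex \<Rightarrow> (nat \<Rightarrow> complex) \<Rightarrow> (nat \<Rightarrow> complex) \<Rightarrow> bool" where
  "solves dt \<alpha> k i z s u \<longleftrightarrow>
     (\<forall>j<k. u j = s j) \<and>
     (\<forall>n\<ge>k. (\<Sum>j<k. wst dt \<alpha> k i n j * u j) + (\<Sum>j\<le>n. omega dt \<alpha> k i (n - j) * u j) = z * u n)"

definition stab_region :: "real \<Rightarrow> real \<Rightarrow> nat \<Rightarrow> nat \<Rightarrow> complex set" where
  "stab_region dt \<alpha> k i =
     {z. \<forall>s. (\<exists>!u. solves dt \<alpha> k i z s u) \<and> (\<forall>u. solves dt \<alpha> k i z s u \<longrightarrow> u \<longlonglongrightarrow> 0)}"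

end

theory Submission
  imports Defs "HOL-Complex_Analysis.Laurent_Convergence"
begin

text \<open>
  With backward differences, the scheme reads
  \<open>\<Gamma>(1-\<alpha>) \<Delta>t\<^sup>\<alpha> D u\<^sub>n = \<Sum>\<^sub>l a\<^sub>n\<^sub>-\<^sub>l \<nabla>u\<^sub>l + \<Sum>\<^sub>l b\<^sub>n\<^sub>-\<^sub>l \<nabla>\<^sup>2u\<^sub>l\<close>, where \<open>a\<close> and \<open>b\<close> are moments of the
  kernel \<open>(m+1-s)\<^sup>-\<^sup>\<alpha>\<close> over \<open>s \<in> [0,1]\<close>. Hence the weights are absolutely summable with sum \<open>0\<close>,
  the starting weights tend to \<open>0\<close>, and the generating function is
  \<open>\<omega>(\<xi>) = (1-\<xi>)a(\<xi>) + (1-\<xi>)\<^sup>2b(\<xi>)\<close> up to the factor \<open>\<Gamma>(1-\<alpha>)\<close>. Symmetrising in \<open>s \<mapsto> 1-s\<close> and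
  writing the kernel as a mixture of exponentials \<open>e\<^sup>-\<^sup>m\<^sup>t\<close> reduces the real part of \<open>\<omega>\<close> to an explicit
  rational function of \<open>\<xi>\<close> and \<open>r = e\<^sup>-\<^sup>t\<close>, which gives \<open>Re \<omega>(\<xi>) \<ge> c (1 - Re \<xi>)\<close> on the unit disc. So
  \<open>\<omega> - z\<close> is bounded away from zero on the disc when \<open>Re z \<le> 0\<close> and \<open>z \<noteq> 0\<close>, and a one-sided Wiener
  lemma shows that the solution of the convolution equation, whose right-hand side tends to \<open>0\<close>,
  tends to \<open>0\<close> as well.
\<close>

section \<open>A Wiener-type lemma for one-sided convolution equations\<close>

text \<open>A lower bound for the symbol on the disc only makes its reciprocal bounded and analytic.
  Such a reciprocal need not have absolutely summable coefficients, and without summability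
  convolution with it need not preserve null sequences; hence the Wiener-type lemma. An approximate
  inverse with l1 error 1/2 is enough, because a contraction argument finishes. The obstacle to
  positivity is the correction term: its real part can be negative, and its factor s - 1/2 changes
  sign inside a subinterval. Pairing s with 1 - s makes its coefficient nonnegative and at most |2s
  - 1| / 2 times the coefficient of the first difference, while per unit coefficient the correction
  is never below -2 times the first-difference term. A share 1 - |2s - 1| therefore survives, and
  its integral over s is positive. The resulting bound degenerates as \<xi> tends to 1, where the
  symbol vanishes; there the distance is supplied by z \<noteq> 0, which is how the imaginary axis
  is included.\<close>

definition fps_l1_le :: "complex fps \<Rightarrow> real \<Rightarrow> bool" where
  "fps_l1_le F M \<longleftrightarrow> (\<forall>N. (\<Sum>m<N. norm (fps_nth F m)) \<le> M)"

lemma fps_l1_le_nonneg: "fps_l1_le F M \<Longrightarrow> 0 \<le> M"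
  unfolding fps_l1_le_def by (metis lessThan_0 sum.empty)

lemma fps_l1_le_mult:
  assumes F: "fps_l1_le F A" and G: "fps_l1_le G B"
  shows "fps_l1_le (F * G) (A * B)"
  unfolding fps_l1_le_def
proof
  fix N
  have "(\<Sum>m<N. norm (fps_nth (F * G) m))
      \<le> (\<Sum>m<N. \<Sum>i\<le>m. norm (fps_nth F i) * norm (fps_nth G (m - i)))"
    by (intro sum_mono) (auto simp: fps_mult_nth atLeast0AtMost norm_mult[symmetric] intro!: norm_sum)
  also have "\<dots> = (\<Sum>(i,j)\<in>{(i,j). i + j < N}. norm (fps_nth F i) * norm (fps_nth G j))"
    by (rule sum.triangle_reindex[symmetric])
  also have "\<dots> \<le> (\<Sum>(i,j)\<in>{..<N}\<times>{..<N}. norm (fps_nth F i) * norm (fps_nth G j))"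
    by (intro sum_mono2) auto
  also have "\<dots> = (\<Sum>i<N. norm (fps_nth F i)) * (\<Sum>j<N. norm (fps_nth G j))"
    by (simp add: sum_product sum.cartesian_product)
  also have "\<dots> \<le> A * B"
    using F G fps_l1_le_nonneg[OF F] by (intro mult_mono) (auto simp: fps_l1_le_def sum_nonneg)
  finally show "(\<Sum>m<N. norm (fps_nth (F * G) m)) \<le> A * B" .
qed

lemma fps_l1_le_one: "fps_l1_le 1 1"
  unfolding fps_l1_le_def
proof
  fix N :: nat
  have "(\<Sum>m<N. norm (fps_nth (1::complex fps) m)) = (\<Sum>m<N. if m = 0 then 1 else 0)"
    by (intro sum.cong) auto
  also have "\<dots> \<le> 1" by (simp add: sum.delta)
  finally show "(\<Sum>m<N. norm (fps_nth (1::complex fps) m)) \<le> 1" .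
qed

lemma fps_l1_le_power: "fps_l1_le F A \<Longrightarrow> fps_l1_le (F ^ n) (A ^ n)"
  by (induction n) (auto intro: fps_l1_le_mult fps_l1_le_one)

lemma fps_l1_le_add:
  assumes "fps_l1_le F A" "fps_l1_le G B"
  shows "fps_l1_le (F + G) (A + B)"
  unfolding fps_l1_le_def
proof
  fix N
  have "(\<Sum>m<N. norm (fps_nth (F + G) m)) \<le> (\<Sum>m<N. norm (fps_nth F m) + norm (fps_nth G m))"
    by (intro sum_mono) (auto intro: norm_triangle_ineq)
  also have "\<dots> \<le> A + B"
    using assms unfolding fps_l1_le_def sum.distrib by (intro add_mono) auto
  finally show "(\<Sum>m<N. norm (fps_nth (F + G) m)) \<le> A + B" .
qed

lemma fps_l1_le_sum:
  assumes "\<And>i. i \<in> I \<Longrightarrow> \<exists>M. fps_l1_le (F i) M" "finite I"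
  shows "\<exists>M. fps_l1_le (sum F I) M"
  using assms(2,1)
proof (induction I rule: finite_induct)
  case empty
  show ?case by (intro exI[of _ 0]) (auto simp: fps_l1_le_def)
next
  case (insert x I)
  then show ?case by (auto intro: fps_l1_le_add)
qed

section \<open>Approximate inversion among absolutely summable power series\<close>

text \<open>Cauchy's estimate on circles of radius r < 1, followed by r -> 1, removes every
  dependence on \<open>m\<close>. The point is the constant: the n-th power costs exactly
  \<open>(1 / c) ^ n\<close>, with no further factor per power.\<close>

lemma norm_inverse_power_fps_nth_le:
  fixes W :: "complex fps"
  assumes rad: "fps_conv_radius W \<ge> 1" and c: "c > 0"
    and lower: "\<And>x. norm x < 1 \<Longrightarrow> c \<le> norm (eval_fps W x)"
  shows "norm (fps_nth (inverse W ^ n) m) \<le> (1 / c) ^ n"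
proof -
  let ?h = "\<lambda>x. inverse (eval_fps W x) ^ n"
  have W0: "fps_nth W 0 \<noteq> 0"
    using lower[of 0] c by (auto simp: eval_fps_at_0)
  have "eval_fps W has_fps_expansion W"
    using rad unfolding has_fps_expansion_def by (auto intro: less_le_trans[of _ 1])
  then have exp: "?h has_fps_expansion inverse W ^ n"
    using W0 by (intro has_fps_expansion_power has_fps_expansion_inverse)
  have ball: "ball (0::complex) 1 \<subseteq> eball 0 (fps_conv_radius W)"
  proof
    fix x :: complex assume "x \<in> ball 0 1"
    then have "ereal (norm x) < 1" by simp
    also have "\<dots> \<le> fps_conv_radius W" by (rule rad)
    finally show "x \<in> eball 0 (fps_conv_radius W)" by (simp add: in_eball_iff)
  qed
  have hol: "?h holomorphic_on ball 0 1"
  proof (intro holomorphic_intros)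
    fix x :: complex assume "x \<in> ball 0 1"
    then show "eval_fps W x \<noteq> 0" using lower[of x] c by auto
  qed (use ball in auto)
  have bound: "norm (fps_nth (inverse W ^ n) m) \<le> (1 / c) ^ n / r ^ m" if r: "0 < r" "r < 1" for r :: real
  proof -
    have "norm ((deriv ^^ m) ?h 0) \<le> fact m * (1 / c) ^ n / r ^ m"
    proof (rule Cauchy_inequality)
      show "?h holomorphic_on ball 0 r"
        by (rule holomorphic_on_subset[OF hol]) (use r in auto)
      show "continuous_on (cball 0 r) ?h"
        by (rule continuous_on_subset[OF holomorphic_on_imp_continuous_on[OF hol]]) (use r in auto)
      fix x :: complex assume "norm (0 - x) = r"
      then have "c \<le> norm (eval_fps W x)" using lower r by simp
      then show "norm (?h x) \<le> (1 / c) ^ n"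
        unfolding norm_power norm_inverse using c
        by (intro power_mono) (auto simp: inverse_eq_divide[symmetric] intro!: le_imp_inverse_le)
    qed (use r in auto)
    then have "norm ((deriv ^^ m) ?h 0 / fact m) \<le> (1 / c) ^ n / r ^ m"
      by (simp add: norm_divide field_simps)
    then show ?thesis by (simp add: fps_nth_fps_expansion[OF exp])
  qed
  have "((\<lambda>r::real. (1 / c) ^ n / r ^ m) \<longlongrightarrow> (1 / c) ^ n / 1 ^ m) (at_left 1)"
    by (intro tendsto_intros) auto
  moreover have "eventually (\<lambda>r::real. norm (fps_nth (inverse W ^ n) m) \<le> (1 / c) ^ n / r ^ m) (at_left 1)"
    using eventually_at_left_real[of 0 1] by (auto elim!: eventually_mono intro: bound)
  ultimately show ?thesis
    using tendsto_lowerbound[of _ _ "at_left (1::real)"] by simp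
qed

text \<open>Split at an index \<open>M\<close> beyond which the tail of the l1 norm is below
  \<open>\<epsilon> / 2\<close>: dilation changes the tail by at most its own norm, and the finite
  head is continuous in \<rho> at 1.\<close>

lemma dilation_l1_close:
  fixes f :: "nat \<Rightarrow> complex"
  assumes "summable (\<lambda>m. norm (f m))" "\<epsilon> > 0"
  obtains \<rho> :: real where "0 < \<rho>" "\<rho> < 1"
    "\<And>N. (\<Sum>m<N. norm (of_real \<rho> ^ m * f m - f m)) \<le> \<epsilon>"
proof -
  obtain M where M: "\<And>n. norm (\<Sum>m=M..<n. norm (f m)) < \<epsilon> / 2"
    using assms unfolding summable_Cauchy by (metis half_gt_zero le_refl)
  have "((\<lambda>\<rho>::real. \<Sum>m<M. (1 - \<rho> ^ m) * norm (f m)) \<longlongrightarrow> (\<Sum>m<M. (1 - 1 ^ m) * norm (f m))) (at_left 1)"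
    by (intro tendsto_intros)
  then have "eventually (\<lambda>\<rho>::real. (\<Sum>m<M. (1 - \<rho> ^ m) * norm (f m)) < \<epsilon> / 2) (at_left 1)"
    using assms(2) by (intro order_tendstoD(2)) auto
  moreover have "eventually (\<lambda>\<rho>::real. \<rho> \<in> {0<..<1}) (at_left 1)"
    by (intro eventually_at_left_real) simp
  ultimately have "eventually (\<lambda>\<rho>::real. (\<Sum>m<M. (1 - \<rho> ^ m) * norm (f m)) < \<epsilon> / 2 \<and> \<rho> \<in> {0<..<1}) (at_left 1)"
    by eventually_elim auto
  then obtain \<rho> :: real where \<rho>: "(\<Sum>m<M. (1 - \<rho> ^ m) * norm (f m)) < \<epsilon> / 2" "0 < \<rho>" "\<rho> < 1"
    by (metis (no_types, lifting) eventually_happens trivial_limit_at_left_real greaterThanLessThan_iff)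
  have pw: "\<rho> ^ m \<le> 1" for m using \<rho> by (intro power_le_one) auto
  have eq: "norm (of_real \<rho> ^ m * f m - f m) = (1 - \<rho> ^ m) * norm (f m)" for m
  proof -
    have "of_real \<rho> ^ m * f m - f m = of_real (\<rho> ^ m - 1) * f m" by (simp add: algebra_simps)
    then show ?thesis using pw[of m] by (simp only: norm_mult norm_of_real) auto
  qed
  have "(\<Sum>m<N. norm (of_real \<rho> ^ m * f m - f m)) \<le> \<epsilon>" for N
  proof -
    have "(\<Sum>m<N. norm (of_real \<rho> ^ m * f m - f m)) \<le> (\<Sum>m<M + N. (1 - \<rho> ^ m) * norm (f m))"
      unfolding eq using pw by (intro sum_mono2) auto
    also have "\<dots> = (\<Sum>m<M. (1 - \<rho> ^ m) * norm (f m)) + (\<Sum>m=M..<M+N. (1 - \<rho> ^ m) * norm (f m))"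
      by (simp only: lessThan_atLeast0 sum.atLeastLessThan_concat le_add1 zero_le)
    also have "(\<Sum>m=M..<M+N. (1 - \<rho> ^ m) * norm (f m)) \<le> (\<Sum>m=M..<M+N. 1 * norm (f m))"
      using \<rho> by (intro sum_mono mult_right_mono) auto
    also have "\<dots> \<le> \<epsilon> / 2" using M[of "M + N"] by (simp add: abs_le_iff)
    finally show ?thesis using \<rho> by linarith
  qed
  with \<rho> show ?thesis by (intro that[of \<rho>]) auto
qed

text \<open>The inverse of \<open>W\<close> is approximated by the Neumann series around the dilation
  \<open>P(x) = W(\<rho> x)\<close>: the coefficients of \<open>1/P\<^sup>n\<close> decay geometrically with constant \<open>c\<^sup>-\<^sup>n\<close>,
  whereas \<open>P - W\<close> is small in \<open>\<ell>\<^sup>1\<close>.\<close>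
lemma almost_inverse_l1:
  fixes W :: "complex fps"
  assumes sum: "summable (\<lambda>m. norm (fps_nth W m))" and c: "c > 0"
    and lower: "\<And>x. norm x < 1 \<Longrightarrow> c \<le> norm (eval_fps W x)"
  obtains Q E M where "Q * W = 1 - E" "fps_l1_le Q M" "fps_l1_le E (1/2)"
proof -
  obtain \<rho> :: real where \<rho>: "0 < \<rho>" "\<rho> < 1"
    and close: "\<And>N. (\<Sum>m<N. norm (of_real \<rho> ^ m * fps_nth W m - fps_nth W m)) \<le> c / 2"
    using dilation_l1_close[OF sum, of "c/2"] c by auto
  define L :: "complex fps" where "L = fps_const (of_real \<rho>) * fps_X"
  have L0: "fps_nth L 0 = 0" by (simp add: L_def)
  define P where "P = fps_compose W L"
  define R where "R = fps_compose (inverse W) L"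
  define d where "d = P - W"
  have W0: "fps_nth W 0 \<noteq> 0"
    using lower[of 0] c by (auto simp: eval_fps_at_0)
  have PR: "R * P = 1"
    unfolding P_def R_def using W0 L0
    by (simp add: fps_compose_mult_distrib[symmetric] inverse_mult_eq_1)
  have rad: "fps_conv_radius W \<ge> 1"
    unfolding fps_conv_radius_def using sum
    by (intro conv_radius_geI_ex') (auto intro!: summable_norm_cancel[of "\<lambda>m. fps_nth W m * _ ^ m"]
      intro: summable_comparison_test'[OF sum, of 0] simp: norm_mult norm_power mult_left_le power_le_one)
  have dbd: "fps_l1_le d (c / 2)"
    unfolding fps_l1_le_def d_def P_def L_def using close by (simp add: fps_compose_linear)
  have Rbd: "fps_l1_le (R ^ n) ((1 / c) ^ n / (1 - \<rho>))" for n
    unfolding fps_l1_le_def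
  proof
    fix N
    have "(\<Sum>m<N. norm (fps_nth (R ^ n) m)) = (\<Sum>m<N. \<rho> ^ m * norm (fps_nth (inverse W ^ n) m))"
      unfolding R_def fps_compose_power[OF L0] unfolding L_def using \<rho>
      by (simp add: fps_compose_linear norm_mult norm_power)
    also have "\<dots> \<le> (\<Sum>m<N. \<rho> ^ m * (1 / c) ^ n)"
      using \<rho> norm_inverse_power_fps_nth_le[OF rad c lower]
      by (intro sum_mono mult_left_mono) auto
    also have "\<dots> = (1 / c) ^ n * (\<Sum>m<N. \<rho> ^ m)" by (simp only: sum_distrib_right[symmetric] mult.commute)
    also have "(\<Sum>m<N. \<rho> ^ m) \<le> (\<Sum>m. \<rho> ^ m)"
      using \<rho> by (intro sum_le_suminf) (auto intro: summable_geometric)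
    also have "\<dots> = 1 / (1 - \<rho>)" using \<rho> by (simp add: suminf_geometric)
    finally show "(\<Sum>m<N. norm (fps_nth (R ^ n) m)) \<le> (1 / c) ^ n / (1 - \<rho>)"
      using c by (simp add: mult_left_mono)
  qed
  \<comment> \<open>The tolerance \<open>c / 2\<close> for \<open>d\<close> against
    \<open>1 / c\<close> for \<open>R\<close> leaves \<open>(1 / 2) ^ n\<close>. The factor
    \<open>1 / (1 - \<rho>)\<close> enters once and not once per power, so high powers are small
    although the bound for n = 1 may exceed 1.\<close>
  have Ebd: "fps_l1_le ((R * d) ^ n) ((1 / 2) ^ n / (1 - \<rho>))" for n
  proof -
    have "fps_l1_le (R ^ n * d ^ n) ((1 / c) ^ n / (1 - \<rho>) * (c / 2) ^ n)"
      by (intro fps_l1_le_mult Rbd fps_l1_le_power dbd)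
    also have "(1 / c) ^ n / (1 - \<rho>) * (c / 2) ^ n = (1 / 2) ^ n / (1 - \<rho>)"
      using c by (simp add: power_mult_distrib[symmetric] power_divide)
    finally show ?thesis by (simp add: power_mult_distrib)
  qed
  obtain N where N: "(1 / 2) ^ N < (1 - \<rho>) / 2"
    using real_arch_pow_inv[of "(1 - \<rho>) / 2" "1/2"] \<rho> by auto
  \<comment> \<open>Truncated Neumann series: \<open>R * W = 1 - R * d\<close>, so the product with
    \<open>W\<close> telescopes.\<close>
  define Q where "Q = R * (\<Sum>i<N. (R * d) ^ i)"
  have "Q * W = (R * P - R * d) * (\<Sum>i<N. (R * d) ^ i)"
    by (simp add: Q_def d_def algebra_simps)
  also have "\<dots> = 1 - (R * d) ^ N"
    by (simp add: PR one_diff_power_eq)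
  finally have 1: "Q * W = 1 - (R * d) ^ N" .
  obtain M where M: "fps_l1_le (\<Sum>i<N. (R * d) ^ i) M"
    using fps_l1_le_sum[of "{..<N}" "\<lambda>i. (R * d) ^ i"] Ebd by auto
  have 2: "fps_l1_le Q ((1 / c) ^ 1 / (1 - \<rho>) * M)"
    unfolding Q_def using Rbd[of 1] by (intro fps_l1_le_mult M) simp
  have "(1 / 2) ^ N / (1 - \<rho>) \<le> 1 / 2" using N \<rho> by (simp add: field_simps)
  then have 3: "fps_l1_le ((R * d) ^ N) (1 / 2)"
    using Ebd[of N] unfolding fps_l1_le_def by (meson order_trans)
  from 1 2 3 show ?thesis by (rule that)
qed

section \<open>Null sequences under convolution with summable sequences\<close>

text \<open>For large n, the summands with \<open>i < N1\<close> meet \<open>G\<close> at indices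
  where it is already small; the others lie in the tail of \<open>F\<close>, where boundedness of
  \<open>G\<close> is enough.\<close>

lemma l1_mult_tendsto_0:
  fixes F G :: "complex fps"
  assumes F: "fps_l1_le F M" and G: "fps_nth G \<longlonglongrightarrow> 0"
  shows "fps_nth (F * G) \<longlonglongrightarrow> 0"
proof (rule LIMSEQ_I)
  fix \<epsilon> :: real assume \<epsilon>: "\<epsilon> > 0"
  have M: "M \<ge> 0" using F by (rule fps_l1_le_nonneg)
  obtain K where K: "K > 0" "\<And>m. norm (fps_nth G m) \<le> K"
    using convergent_imp_Bseq[OF convergentI[OF G]] by (auto elim: BseqE)
  have sF: "summable (\<lambda>m. norm (fps_nth F m))"
    using F unfolding fps_l1_le_def by (intro bounded_imp_summable[of _ M]) (auto simp: lessThan_Suc_atMost[symmetric] simp del: sum.lessThan_Suc)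
  define \<delta> where "\<delta> = \<epsilon> / (2 * (M + K))"
  have \<delta>: "\<delta> > 0" using \<epsilon> K M by (auto simp: \<delta>_def)
  obtain N1 where N1: "\<And>m n. m \<ge> N1 \<Longrightarrow> norm (\<Sum>m=m..<n. norm (fps_nth F m)) < \<delta>"
    using sF \<delta> unfolding summable_Cauchy by blast
  obtain N2 where N2: "\<And>m. m \<ge> N2 \<Longrightarrow> norm (fps_nth G m) < \<delta>"
    using LIMSEQ_D[OF G \<delta>] by auto
  have "norm (fps_nth (F * G) n - 0) < \<epsilon>" if n: "n \<ge> N1 + N2" for n
  proof -
    have "norm (fps_nth (F * G) n) \<le> (\<Sum>i<Suc n. norm (fps_nth F i) * norm (fps_nth G (n - i)))"
      by (auto simp: fps_mult_nth atLeast0AtMost lessThan_Suc_atMost norm_mult[symmetric] intro!: norm_sum)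
    also have "\<dots> = (\<Sum>i<N1. norm (fps_nth F i) * norm (fps_nth G (n - i)))
        + (\<Sum>i=N1..<Suc n. norm (fps_nth F i) * norm (fps_nth G (n - i)))"
      using n by (simp only: lessThan_atLeast0 sum.atLeastLessThan_concat zero_le)
    also have "(\<Sum>i<N1. norm (fps_nth F i) * norm (fps_nth G (n - i))) \<le> (\<Sum>i<N1. norm (fps_nth F i) * \<delta>)"
      using n by (intro sum_mono mult_left_mono less_imp_le[OF N2]) auto
    also have "\<dots> \<le> M * \<delta>"
      using F \<delta> unfolding fps_l1_le_def sum_distrib_right[symmetric] by (intro mult_right_mono) auto
    also have "(\<Sum>i=N1..<Suc n. norm (fps_nth F i) * norm (fps_nth G (n - i)))
        \<le> (\<Sum>i=N1..<Suc n. norm (fps_nth F i) * K)"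
      by (intro sum_mono mult_left_mono K) auto
    also have "\<dots> \<le> \<delta> * K"
      unfolding sum_distrib_right[symmetric] using N1[of N1 "Suc n"] K
      by (intro mult_right_mono) auto
    finally have "norm (fps_nth (F * G) n) \<le> (M + K) * \<delta>" by (simp add: algebra_simps)
    also have "\<dots> = \<epsilon> / 2" using K(1) M by (simp add: \<delta>_def field_simps)
    finally show ?thesis using \<epsilon> by simp
  qed
  then show "\<exists>no. \<forall>n\<ge>no. norm (fps_nth (F * G) n - 0) < \<epsilon>" by blast
qed

text \<open>A largest term among the first n satisfies B \<le> K + B / 2, which bounds
  \<open>U\<close> by \<open>2 * K\<close>. After that, every eventual bound b improves to 3/4 b,
  and iteration forces the limit 0.\<close>

lemma l1_contraction_tendsto_0:
  fixes E U V :: "complex fps"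
  assumes eq: "U = V + E * U" and E: "fps_l1_le E (1/2)" and V: "fps_nth V \<longlonglongrightarrow> 0"
  shows "fps_nth U \<longlonglongrightarrow> 0"
proof -
  obtain K where K: "K > 0" "\<And>m. norm (fps_nth V m) \<le> K"
    using convergent_imp_Bseq[OF convergentI[OF V]] by (auto elim: BseqE)
  have Ule: "norm (fps_nth U n) \<le> norm (fps_nth V n)
      + (\<Sum>i\<le>n. norm (fps_nth E i) * norm (fps_nth U (n - i)))" for n
  proof -
    have "fps_nth U n = fps_nth V n + fps_nth (E * U) n"
      by (subst eq) simp
    then have "norm (fps_nth U n) \<le> norm (fps_nth V n) + norm (fps_nth (E * U) n)"
      using norm_triangle_ineq by metis
    also have "norm (fps_nth (E * U) n) \<le> (\<Sum>i\<le>n. norm (fps_nth E i) * norm (fps_nth U (n - i)))"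
      by (auto simp: fps_mult_nth atLeast0AtMost norm_mult[symmetric] intro!: norm_sum)
    finally show ?thesis by simp
  qed
  have Ehalf: "(\<Sum>i\<le>n. norm (fps_nth E i)) \<le> 1 / 2" for n
    using E unfolding fps_l1_le_def lessThan_Suc_atMost[symmetric] by blast
  have bdd: "norm (fps_nth U n) \<le> 2 * K" for n
  proof -
    define B where "B = Max ((\<lambda>j. norm (fps_nth U j)) ` {..n})"
    have B: "norm (fps_nth U j) \<le> B" if "j \<le> n" for j
      unfolding B_def using that by (intro Max_ge) auto
    have B0: "B \<ge> 0" using B[of 0] norm_ge_zero order_trans by blast
    obtain j where j: "j \<le> n" "B = norm (fps_nth U j)"
      using Max_in[of "(\<lambda>j. norm (fps_nth U j)) ` {..n}", folded B_def] by auto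
    have "B \<le> K + (\<Sum>i\<le>j. norm (fps_nth E i) * B)"
      unfolding j(2) using j(1)
      by (intro order_trans[OF Ule[of j]] add_mono K sum_mono mult_left_mono) (auto simp: j(2)[symmetric] intro: B)
    also have "\<dots> \<le> K + 1/2 * B"
      unfolding sum_distrib_right[symmetric] by (intro add_left_mono mult_right_mono Ehalf B0)
    finally show ?thesis using B[of n] by simp
  qed
  have step: "\<exists>N. \<forall>n\<ge>N. norm (fps_nth U n) \<le> 3/4 * b"
    if b: "b > 0" and N0: "\<forall>n\<ge>N0. norm (fps_nth U n) \<le> b" for b N0
  proof -
    \<comment> \<open>\<open>T\<close> holds the initial terms, which need not obey the bound b. It
      has finite support, so \<open>V + E * T\<close> is still null and eventually below b / 4; the
      remaining terms contribute at most b / 2.\<close>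
    define T where "T = Abs_fps (\<lambda>n. if n < N0 then fps_nth U n else 0)"
    have "fps_nth T \<longlonglongrightarrow> 0"
      by (rule tendsto_eventually) (auto simp: T_def eventually_sequentially intro!: exI[of _ N0])
    then have "fps_nth (V + E * T) \<longlonglongrightarrow> 0 + 0"
      unfolding fps_add_nth by (intro tendsto_add V l1_mult_tendsto_0[OF E])
    then obtain N where N: "\<And>n. n \<ge> N \<Longrightarrow> norm (fps_nth (V + E * T) n) < b / 4"
      using LIMSEQ_D[of "fps_nth (V + E * T)" 0 "b/4"] b by (metis add_0 diff_zero divide_pos_pos zero_less_numeral)
    have "norm (fps_nth U n) \<le> 3/4 * b" if "n \<ge> N" for n
    proof -
      have "U = (V + E * T) + E * (U - T)" using eq by (simp add: algebra_simps)
      then have "fps_nth U n = fps_nth (V + E * T) n + fps_nth (E * (U - T)) n"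
        by (metis fps_add_nth)
      then have "norm (fps_nth U n) \<le> norm (fps_nth (V + E * T) n) + norm (fps_nth (E * (U - T)) n)"
        by (simp only: norm_triangle_ineq)
      also have "norm (fps_nth (E * (U - T)) n) \<le> (\<Sum>i\<le>n. norm (fps_nth E i) * norm (fps_nth (U - T) (n - i)))"
        by (auto simp: fps_mult_nth atLeast0AtMost norm_mult[symmetric] simp del: fps_sub_nth intro!: norm_sum)
      also have "\<dots> \<le> (\<Sum>i\<le>n. norm (fps_nth E i) * b)"
        using N0 b by (intro sum_mono mult_left_mono) (auto simp: T_def)
      also have "\<dots> \<le> 1/2 * b"
        unfolding sum_distrib_right[symmetric] using b by (intro mult_right_mono Ehalf) auto
      finally show ?thesis using N[OF that] by simp
    qed
    then show ?thesis by blast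
  qed
  have iter: "\<exists>N. \<forall>n\<ge>N. norm (fps_nth U n) \<le> (3/4) ^ j * (2 * K)" for j
  proof (induction j)
    case 0
    then show ?case using bdd by auto
  next
    case (Suc j)
    then show ?case using step[of "(3/4) ^ j * (2 * K)"] K by (auto simp: mult_ac)
  qed
  show ?thesis
  proof (rule LIMSEQ_I)
    fix \<epsilon> :: real assume "\<epsilon> > 0"
    then obtain j where "(3/4::real) ^ j < \<epsilon> / (2 * K)"
      using real_arch_pow_inv[of "\<epsilon> / (2 * K)" "3/4"] K by auto
    then have "(3/4) ^ j * (2 * K) < \<epsilon>" using K by (simp add: field_simps)
    with iter[of j] show "\<exists>no. \<forall>n\<ge>no. norm (fps_nth U n - 0) < \<epsilon>"
      by (metis diff_zero le_less_trans)
  qed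
qed

theorem convolution_solution_tendsto_0:
  fixes f u g :: "nat \<Rightarrow> complex"
  assumes "summable (\<lambda>m. norm (f m))" "c > 0"
    and "\<And>x. norm x < 1 \<Longrightarrow> c \<le> norm (\<Sum>m. f m * x ^ m)"
    and conv: "\<And>n. (\<Sum>j\<le>n. f (n - j) * u j) = g n" and g: "g \<longlonglongrightarrow> 0"
  shows "u \<longlonglongrightarrow> 0"
proof -
  define W where "W = Abs_fps f"
  obtain Q E M where Q: "Q * W = 1 - E" "fps_l1_le Q M" "fps_l1_le E (1/2)"
    using almost_inverse_l1[of W c] assms by (auto simp: W_def eval_fps_def)
  have WU: "W * Abs_fps u = Abs_fps g"
  proof (rule fps_ext)
    fix n
    have "fps_nth (W * Abs_fps u) n = fps_nth (Abs_fps u * W) n" by (simp add: mult.commute)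
    also have "\<dots> = g n"
      using conv[of n] by (simp add: fps_mult_nth W_def atLeast0AtMost mult.commute[of "u _"])
    finally show "fps_nth (W * Abs_fps u) n = fps_nth (Abs_fps g) n" by simp
  qed
  have "Q * Abs_fps g = (1 - E) * Abs_fps u"
    by (simp add: WU[symmetric] Q(1)[symmetric] mult.assoc)
  then have eq: "Abs_fps u = Q * Abs_fps g + E * Abs_fps u"
    by (simp add: algebra_simps)
  have "fps_nth (Q * Abs_fps g) \<longlonglongrightarrow> 0"
    using g by (intro l1_mult_tendsto_0[OF Q(2)]) (simp add: Abs_fps_inverse)
  from l1_contraction_tendsto_0[OF eq Q(3) this] have "fps_nth (Abs_fps u) \<longlonglongrightarrow> 0" .
  then show ?thesis by (simp add: Abs_fps_inverse)
qed

section \<open>Positivity for geometric kernels\<close>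

text \<open>A concave function lies above its chord. It is used with q = |\<xi>|^2 at fixed x = Re
  \<xi>: then q runs through [x^2, 1], whose ends are real \<xi> and the unit circle, and at both
  ends the expressions below split into terms of visible sign.\<close>

lemma nonneg_of_concave_quadratic:
  fixes x q A :: real
  assumes q: "x\<^sup>2 \<le> q" "q \<le> 1" and A: "A \<ge> 0"
    and f: "\<And>q. f q = c0 + c1 * q - A * q\<^sup>2" and f1: "f 1 \<ge> 0" and fx: "f (x\<^sup>2) \<ge> 0"
  shows "f q \<ge> 0"
proof (cases "x\<^sup>2 = 1")
  case True
  then show ?thesis using q f1 by auto
next
  case False
  then have x: "1 - x\<^sup>2 > 0" using q by linarith
  have "(1 - x\<^sup>2) * f q = (1 - q) * f (x\<^sup>2) + (q - x\<^sup>2) * f 1 + A * ((1 - q) * (q - x\<^sup>2) * (1 - x\<^sup>2))"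
    unfolding f by (simp add: algebra_simps power2_eq_square)
  also have "\<dots> \<ge> 0"
    using q x A f1 fx by (intro add_nonneg_nonneg mult_nonneg_nonneg) auto
  finally show ?thesis using x by (simp add: zero_le_mult_iff)
qed

lemma Re_sq_bounds:
  fixes \<xi> :: complex
  assumes "norm \<xi> \<le> 1"
  shows "(Re \<xi>)\<^sup>2 \<le> (norm \<xi>)\<^sup>2" "(norm \<xi>)\<^sup>2 \<le> 1" "Re \<xi> \<le> 1" "-1 \<le> Re \<xi>"
proof -
  show "(Re \<xi>)\<^sup>2 \<le> (norm \<xi>)\<^sup>2" by (simp add: cmod_power2)
  show "(norm \<xi>)\<^sup>2 \<le> 1" using assms by (simp add: power_le_one)
  show "Re \<xi> \<le> 1" "-1 \<le> Re \<xi>" using abs_Re_le_cmod[of \<xi>] assms by auto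
qed

section \<open>Real parts of the rational symbols for one ratio r\<close>

text \<open>The right-hand side is the numerator of Re ((1 - \<xi>) / (1 - r \<xi>)) over |1 - r
  \<xi>|^2. Everything reduces to 2x - 1 \<le> x^2 \<le> |\<xi>|^2 with x = Re \<xi>.\<close>

lemma Re_first_difference_ge:
  fixes \<xi> :: complex
  assumes "norm \<xi> \<le> 1" "0 \<le> r" "r \<le> 1"
  shows "(1 - Re \<xi>) * (1 - r) \<le> Re ((1 - \<xi>) * (1 - of_real r * cnj \<xi>))"
proof -
  note b = Re_sq_bounds[OF assms(1)]
  have eq: "Re ((1 - \<xi>) * (1 - of_real r * cnj \<xi>)) = 1 + r * (norm \<xi>)\<^sup>2 - (1 + r) * Re \<xi>"
    by (simp add: cmod_power2) (simp add: algebra_simps power2_eq_square)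
  have "(1 - Re \<xi>) * (1 - r) = 1 + r * (2 * Re \<xi> - 1) - (1 + r) * Re \<xi>" by (simp add: algebra_simps)
  also have "2 * Re \<xi> - 1 \<le> (Re \<xi>)\<^sup>2" using zero_le_power2[of "Re \<xi> - 1"] by (simp add: power2_diff)
  also have "\<dots> \<le> (norm \<xi>)\<^sup>2" by (rule b)
  finally show ?thesis unfolding eq using assms by (simp add: mult_left_mono)
qed

text \<open>For \<open>(2,1)\<close> the correction series with ratio r sums to (1 - \<xi>)^2 / (1 -
  r \<xi>); this compares its numerator with that of the first difference. The expression is affine
  in |\<xi>|^2, so the two endpoints decide.\<close>

lemma Re_second_difference_ge:
  fixes \<xi> :: complex
  assumes "norm \<xi> \<le> 1" "0 \<le> r" "r \<le> 1"
  shows "0 \<le> 2 * Re ((1 - \<xi>) * (1 - of_real r * cnj \<xi>)) + Re ((1 - \<xi>)\<^sup>2 * (1 - of_real r * cnj \<xi>))"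
proof -
  note b = Re_sq_bounds[OF assms(1)]
  define x where "x = Re \<xi>"
  define f where "f q = 3 - (4 + 3 * r) * x + 2 * x\<^sup>2 - q + 4 * r * q - r * q * x" for q
  have eq: "2 * Re ((1 - \<xi>) * (1 - of_real r * cnj \<xi>)) + Re ((1 - \<xi>)\<^sup>2 * (1 - of_real r * cnj \<xi>))
      = f ((norm \<xi>)\<^sup>2)"
    unfolding cmod_power2 f_def x_def by (simp add: power2_eq_square) (simp add: algebra_simps)
  have "r * x \<le> r * 1" using b assms by (intro mult_left_mono) (auto simp: x_def)
  then have rx: "r * x \<le> 1" using assms by simp
  have "f 1 = 2 * ((1 - x) * (1 + 2 * r - x))" by (simp add: f_def algebra_simps power2_eq_square)
  also have "\<dots> \<ge> 0" using b assms by (simp add: x_def)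
  finally have 1: "f 1 \<ge> 0" .
  have "f (x\<^sup>2) = (1 - x) * (1 - r * x) * (3 - x)" by (simp add: f_def algebra_simps power2_eq_square)
  also have "\<dots> \<ge> 0" using b rx by (simp add: x_def)
  finally have 2: "f (x\<^sup>2) \<ge> 0" .
  show ?thesis unfolding eq
    by (rule nonneg_of_concave_quadratic[of x _ 0 f "3 - (4 + 3 * r) * x + 2 * x\<^sup>2" "- 1 + 4 * r - r * x"])
      (use b 1 2 in \<open>auto simp: x_def f_def algebra_simps\<close>)
qed

text \<open>Counterpart for \<open>(2,2)\<close>: the factor 1 + r - r \<xi> is what remains of 1 +
  r / (1 - r \<xi>), the sum of the geometric series whose exponents are lowered by one except in
  the first term.\<close>

lemma Re_shifted_second_difference_ge:
  fixes \<xi> :: complex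
  assumes "norm \<xi> \<le> 1" "0 \<le> r" "r \<le> 1"
  shows "0 \<le> 2 * Re ((1 - \<xi>) * (1 - of_real r * cnj \<xi>))
    + Re ((1 - \<xi>)\<^sup>2 * (1 + of_real r - of_real r * \<xi>) * (1 - of_real r * cnj \<xi>))"
proof -
  note b = Re_sq_bounds[OF assms(1)]
  define x where "x = Re \<xi>"
  define f where "f q = 2 * (1 + r * q - (1 + r) * x)
    + (1 + r + r\<^sup>2 * q) * (1 - 2 * x + 2 * x\<^sup>2 - q) - r * (x - 2 * (2 * x\<^sup>2 - q) + (4 * x ^ 3 - 3 * x * q))
    - r * (1 + r) * (x - 2 * q + q * x)" for q
  have eq: "2 * Re ((1 - \<xi>) * (1 - of_real r * cnj \<xi>))
    + Re ((1 - \<xi>)\<^sup>2 * (1 + of_real r - of_real r * \<xi>) * (1 - of_real r * cnj \<xi>))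
      = f ((norm \<xi>)\<^sup>2)"
    unfolding cmod_power2 f_def x_def by (simp add: power2_eq_square power3_eq_cube) (simp add: algebra_simps)
  have "r * x \<le> r * 1" using b assms by (intro mult_left_mono) (auto simp: x_def)
  then have rx: "r * x \<le> 1" using assms by simp
  have "f 1 = 2 * ((1 - x) * ((1 + r + r\<^sup>2) * (1 - x) + 2 * r * x\<^sup>2))"
    by (simp add: f_def algebra_simps power2_eq_square power3_eq_cube)
  also have "\<dots> \<ge> 0" using b assms by (simp add: x_def)
  finally have 1: "f 1 \<ge> 0" .
  have "f (x\<^sup>2) = (1 - x) * (1 - r * x) * (2 + (1 - x) * (r + (1 - r * x)))"
    by (simp add: f_def algebra_simps power2_eq_square power3_eq_cube)
  also have "\<dots> \<ge> 0" using b rx assms by (intro mult_nonneg_nonneg add_nonneg_nonneg) (auto simp: x_def)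
  finally have 2: "f (x\<^sup>2) \<ge> 0" .
  \<comment> \<open>The coefficient of q^2 is -r^2, which gives concavity; the other two
    coefficients are recovered from the values at 0 and 1.\<close>
  have fq: "f q = f 0 + (f 1 - f 0 + r\<^sup>2) * q - r\<^sup>2 * q\<^sup>2" for q
    by (simp add: f_def algebra_simps power2_eq_square power3_eq_cube)
  show ?thesis unfolding eq
    by (rule nonneg_of_concave_quadratic[OF _ _ _ fq 1 2]) (use b in \<open>auto simp: x_def\<close>)
qed

text \<open>Weight of the \<open>m\<close>-th correction moment in the generating function: absent for the
  piecewise linear method; for \<open>(2,2)\<close> the last two subintervals share one quadratic, which is
  what the truncated subtraction \<open>0 - 1 = 0\<close> expresses.\<close>
definition corr_power :: "nat \<Rightarrow> nat \<Rightarrow> complex \<Rightarrow> nat \<Rightarrow> complex" where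
  "corr_power k i \<xi> m = (if k = 1 then 0 else if i = 1 then \<xi> ^ m else \<xi> ^ (m - 1))"

lemma norm_corr_power_le: "norm (corr_power k i \<xi> (Suc m)) \<le> norm \<xi> ^ m" if "norm \<xi> \<le> 1"
  using that by (auto simp: corr_power_def norm_power norm_mult mult_left_le_one_le)

lemma summable_corr_power: "norm \<xi> < 1 \<Longrightarrow> summable (\<lambda>m. norm (corr_power k i \<xi> m))"
  using norm_corr_power_le[of \<xi> k i]
  by (subst summable_Suc_iff[symmetric]) (auto intro!: summable_comparison_test'[OF summable_geometric[of "norm \<xi>"], of 0])

lemma corr_power_sums:
  assumes "norm \<xi> < 1" "0 \<le> r" "r \<le> (1::real)"
  shows "(\<lambda>m. of_real (r ^ m) * corr_power k i \<xi> m) sums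
    ((if k = 1 then 0 else if i = 1 then 1 else 1 + of_real r - of_real r * \<xi>) / (1 - of_real r * \<xi>))"
proof -
  have "norm (of_real r * \<xi>) < 1"
    using assms by (simp add: norm_mult) (meson le_less_trans mult_left_le_one_le norm_ge_zero)
  then have geo: "(\<lambda>m. (of_real r * \<xi>) ^ m) sums (1 / (1 - of_real r * \<xi>))"
    and ne: "1 - of_real r * \<xi> \<noteq> 0"
    by (auto intro: geometric_sums)
  have "(\<lambda>m. of_real r * (of_real r * \<xi>) ^ m) sums (of_real r * (1 / (1 - of_real r * \<xi>)))"
    by (intro sums_mult geo)
  then have "(\<lambda>m. of_real (r ^ Suc m) * \<xi> ^ (Suc m - 1)) sums (of_real r * (1 / (1 - of_real r * \<xi>)))"
    by (simp add: power_mult_distrib mult_ac)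
  from sums_Suc[OF this]
  have "(\<lambda>m. of_real (r ^ m) * \<xi> ^ (m - 1)) sums (of_real r * (1 / (1 - of_real r * \<xi>)) + 1)" by simp
  also have "of_real r * (1 / (1 - of_real r * \<xi>)) + 1 = (1 + of_real r - of_real r * \<xi>) / (1 - of_real r * \<xi>)"
    using ne by (simp add: field_simps)
  finally show ?thesis
    using geo by (auto simp: corr_power_def power_mult_distrib)
qed

section \<open>Lower bound for a geometric kernel\<close>

text \<open>The moments are real, so the real part of the generating function is a real series in
  them: \<open>diff_weight\<close> multiplies \<open>lin_moment\<close>, and
  \<open>corr_weight\<close> below multiplies \<open>corr_moment\<close>.\<close>

definition diff_weight :: "complex \<Rightarrow> nat \<Rightarrow> real" where
  "diff_weight \<xi> m = Re ((1 - \<xi>) * \<xi> ^ m)"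

definition corr_weight :: "nat \<Rightarrow> nat \<Rightarrow> complex \<Rightarrow> nat \<Rightarrow> real" where
  "corr_weight k i \<xi> m = Re ((1 - \<xi>)\<^sup>2 * corr_power k i \<xi> m)"

lemma summable_weights:
  assumes "norm \<xi> < 1"
  shows "summable (\<lambda>m. \<bar>diff_weight \<xi> m\<bar> + \<bar>corr_weight k i \<xi> m\<bar>)"
proof (intro summable_add)
  show "summable (\<lambda>m. \<bar>diff_weight \<xi> m\<bar>)"
  proof (rule summable_comparison_test'[of _ 0])
    show "summable (\<lambda>m. norm (1 - \<xi>) * norm \<xi> ^ m)"
      using assms by (intro summable_mult summable_geometric) auto
    show "norm \<bar>diff_weight \<xi> n\<bar> \<le> norm (1 - \<xi>) * norm \<xi> ^ n" for n
      using abs_Re_le_cmod[of "(1 - \<xi>) * \<xi> ^ n"] by (simp add: diff_weight_def norm_mult norm_power)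
  qed
  show "summable (\<lambda>m. \<bar>corr_weight k i \<xi> m\<bar>)"
  proof (rule summable_comparison_test'[of _ 0])
    show "summable (\<lambda>m. norm ((1 - \<xi>)\<^sup>2) * norm (corr_power k i \<xi> m))"
      using assms by (intro summable_mult summable_corr_power) auto
    show "norm \<bar>corr_weight k i \<xi> n\<bar> \<le> norm ((1 - \<xi>)\<^sup>2) * norm (corr_power k i \<xi> n)" for n
      using abs_Re_le_cmod[of "(1 - \<xi>)\<^sup>2 * corr_power k i \<xi> n"] by (simp add: corr_weight_def norm_mult)
  qed
qed

text \<open>The correction term is at least \<open>-2\<gamma>\<close> times the first-difference term, hence is absorbed
  by the latter since \<open>2\<gamma> \<le> \<eta>\<beta>\<close>.\<close>
lemma geometric_kernel_lower_bound:
  assumes \<xi>: "norm \<xi> < 1" and r: "0 \<le> r" "r \<le> 1"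
    and \<gamma>: "0 \<le> \<gamma>" "2 * \<gamma> \<le> \<eta> * \<beta>" and \<eta>: "\<eta> \<le> 1" and \<beta>: "0 \<le> \<beta>"
  shows "(1 - \<eta>) * \<beta> * ((1 - Re \<xi>) * (1 - r)) / 4
    \<le> (\<Sum>m. r ^ m * (\<beta> * diff_weight \<xi> m + \<gamma> * corr_weight k i \<xi> m))"
proof -
  \<comment> \<open>\<open>w\<close> is the numerator of (1 - \<xi>) / d once the denominator has
    been made real by the conjugate of \<open>d\<close>.\<close>
  define w where "w = (1 - \<xi>) * (1 - of_real r * cnj \<xi>)"
  define N where "N = (if k = 1 then 0 else if i = 1 then 1 else 1 + of_real r - of_real r * \<xi>)"
  define d where "d = 1 - of_real r * \<xi>"
  have Rm: "Re (of_real a * z) = a * Re z" for a z by simp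
  have rx: "norm (of_real r * \<xi>) < 1"
    using \<xi> r by (simp add: norm_mult) (meson le_less_trans mult_left_le_one_le norm_ge_zero)
  then have ne: "d \<noteq> 0" unfolding d_def by auto
  have T1: "(1 - Re \<xi>) * (1 - r) \<le> Re w"
    unfolding w_def using \<xi> r by (intro Re_first_difference_ge) auto
  have nn: "0 \<le> (1 - Re \<xi>) * (1 - r)" using Re_sq_bounds[of \<xi>] \<xi> r by auto
  have T: "0 \<le> 2 * Re w + Re ((1 - \<xi>) * N * w)"
  proof -
    have "Re w \<ge> 0" using T1 nn by linarith
    then show ?thesis
      using Re_second_difference_ge[of \<xi> r] Re_shifted_second_difference_ge[of \<xi> r] \<xi> r
      by (auto simp: N_def w_def power2_eq_square mult.assoc mult.left_commute)
  qed
  have "(\<lambda>m. of_real \<beta> * ((1 - \<xi>) * (of_real r * \<xi>) ^ m) + of_real \<gamma> * ((1 - \<xi>)\<^sup>2 * (of_real (r ^ m) * corr_power k i \<xi> m)))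
      sums (of_real \<beta> * ((1 - \<xi>) * (1 / d)) + of_real \<gamma> * ((1 - \<xi>)\<^sup>2 * (N / d)))"
    unfolding d_def N_def using \<xi> r rx
    by (intro sums_add sums_mult geometric_sums corr_power_sums) auto
  then have "(\<lambda>m. Re (of_real \<beta> * ((1 - \<xi>) * (of_real r * \<xi>) ^ m) + of_real \<gamma> * ((1 - \<xi>)\<^sup>2 * (of_real (r ^ m) * corr_power k i \<xi> m))))
      sums Re (of_real \<beta> * ((1 - \<xi>) * (1 / d)) + of_real \<gamma> * ((1 - \<xi>)\<^sup>2 * (N / d)))"
    by (rule sums_Re)
  also have "(\<lambda>m. Re (of_real \<beta> * ((1 - \<xi>) * (of_real r * \<xi>) ^ m) + of_real \<gamma> * ((1 - \<xi>)\<^sup>2 * (of_real (r ^ m) * corr_power k i \<xi> m))))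
      = (\<lambda>m. r ^ m * (\<beta> * diff_weight \<xi> m + \<gamma> * corr_weight k i \<xi> m))"
  proof
    fix m
    have "of_real \<beta> * ((1 - \<xi>) * (of_real r * \<xi>) ^ m) + of_real \<gamma> * ((1 - \<xi>)\<^sup>2 * (of_real (r ^ m) * corr_power k i \<xi> m))
      = of_real (r ^ m * \<beta>) * ((1 - \<xi>) * \<xi> ^ m) + of_real (r ^ m * \<gamma>) * ((1 - \<xi>)\<^sup>2 * corr_power k i \<xi> m)"
      by (simp add: power_mult_distrib mult_ac)
    then show "Re (of_real \<beta> * ((1 - \<xi>) * (of_real r * \<xi>) ^ m) + of_real \<gamma> * ((1 - \<xi>)\<^sup>2 * (of_real (r ^ m) * corr_power k i \<xi> m)))
      = r ^ m * (\<beta> * diff_weight \<xi> m + \<gamma> * corr_weight k i \<xi> m)"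
      by (simp only: plus_complex.sel Rm diff_weight_def corr_weight_def) (simp add: algebra_simps)
  qed
  finally have S: "(\<Sum>m. r ^ m * (\<beta> * diff_weight \<xi> m + \<gamma> * corr_weight k i \<xi> m))
      = Re (of_real \<beta> * ((1 - \<xi>) * (1 / d)) + of_real \<gamma> * ((1 - \<xi>)\<^sup>2 * (N / d)))"
    by (rule sums_unique[symmetric])
  have w: "w = (1 - \<xi>) * cnj d" by (simp add: w_def d_def)
  have dd: "d * cnj d = of_real ((norm d)\<^sup>2)" by (simp add: complex_norm_square[symmetric])
  have "of_real \<beta> * ((1 - \<xi>) * (1 / d)) + of_real \<gamma> * ((1 - \<xi>)\<^sup>2 * (N / d))
      = (of_real \<beta> * ((1 - \<xi>) * cnj d) + of_real \<gamma> * ((1 - \<xi>) * N * ((1 - \<xi>) * cnj d))) * (1 / (d * cnj d))"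
    using ne by (simp add: field_simps power2_eq_square)
  also have "\<dots> = (of_real \<beta> * w + of_real \<gamma> * ((1 - \<xi>) * N * w)) / of_real ((norm d)\<^sup>2)"
    unfolding dd w by simp
  finally have "Re (of_real \<beta> * ((1 - \<xi>) * (1 / d)) + of_real \<gamma> * ((1 - \<xi>)\<^sup>2 * (N / d)))
      = (\<beta> * Re w + \<gamma> * Re ((1 - \<xi>) * N * w)) / (norm d)\<^sup>2"
    by (simp only: Re_divide_of_real plus_complex.sel Rm)
  note S = S[unfolded this]
  have "(1 - \<eta>) * \<beta> * Re w \<le> \<beta> * Re w + \<gamma> * Re ((1 - \<xi>) * N * w)"
  proof -
    have "- (2 * Re w) * \<gamma> \<le> Re ((1 - \<xi>) * N * w) * \<gamma>" using T \<gamma> by (intro mult_right_mono) auto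
    moreover have "2 * \<gamma> * Re w \<le> \<eta> * \<beta> * Re w" using \<gamma> T1 nn by (intro mult_right_mono) auto
    ultimately show ?thesis by (simp add: algebra_simps)
  qed
  moreover have "(1 - \<eta>) * \<beta> * ((1 - Re \<xi>) * (1 - r)) \<le> (1 - \<eta>) * \<beta> * Re w"
    using \<eta> \<beta> T1 by (intro mult_left_mono) auto
  ultimately have num: "(1 - \<eta>) * \<beta> * ((1 - Re \<xi>) * (1 - r)) \<le> \<beta> * Re w + \<gamma> * Re ((1 - \<xi>) * N * w)"
    by linarith
  \<comment> \<open>The denominator |d|^2 is at most 4, whence the factor 1/4 in the bound.\<close>
  have "norm d \<le> 2" unfolding d_def using rx norm_triangle_ineq4[of 1 "of_real r * \<xi>"] by auto
  then have d4: "(norm d)\<^sup>2 \<le> 4" using power_mono[of "norm d" 2 2] by simp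
  have "(1 - \<eta>) * \<beta> * ((1 - Re \<xi>) * (1 - r)) / 4 \<le> (1 - \<eta>) * \<beta> * ((1 - Re \<xi>) * (1 - r)) / (norm d)\<^sup>2"
    using d4 ne \<eta> \<beta> r Re_sq_bounds(3)[of \<xi>] \<xi> by (intro divide_left_mono mult_nonneg_nonneg) auto
  also have "\<dots> \<le> (\<beta> * Re w + \<gamma> * Re ((1 - \<xi>) * N * w)) / (norm d)\<^sup>2"
    using num by (intro divide_right_mono) auto
  finally show ?thesis unfolding S .
qed

text \<open>Dominated convergence with majorant \<open>h x * suminf c\<close> permits termwise
  integration, and a pointwise lower bound for the series passes to the series of integrals. It
  serves twice: over the mixing variable t and over the local variable s.\<close>

lemma has_integral_suminf_lower_bound:
  fixes f :: "nat \<Rightarrow> real \<Rightarrow> real"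
  assumes f: "\<And>m. (f m has_integral I m) S" and h: "h integrable_on S"
    and le: "\<And>m x. x \<in> S \<Longrightarrow> \<bar>f m x\<bar> \<le> h x * c m" and c: "summable c" "\<And>m. 0 \<le> c m"
    and h0: "\<And>x. x \<in> S \<Longrightarrow> 0 \<le> h x"
    and L: "(L has_integral J) S" "\<And>x. x \<in> S \<Longrightarrow> L x \<le> (\<Sum>m. f m x)"
  shows "summable I \<and> J \<le> (\<Sum>m. I m)"
proof -
  let ?F = "\<lambda>n x. \<Sum>m<n. f m x" and ?G = "\<lambda>x. \<Sum>m. f m x"
  have F: "(?F n has_integral (\<Sum>m<n. I m)) S" for n
    by (intro has_integral_sum f) auto
  have sm: "summable (\<lambda>m. f m x)" if "x \<in> S" for x
    by (rule summable_comparison_test'[OF summable_mult[OF c(1), of "h x"], of 0]) (use le[OF that] in auto)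
  have bd: "norm (?F n x) \<le> h x * suminf c" if "x \<in> S" for n x
  proof -
    have "norm (?F n x) \<le> (\<Sum>m<n. \<bar>f m x\<bar>)" by (rule order_trans[OF norm_sum]) simp
    also have "\<dots> \<le> (\<Sum>m<n. h x * c m)" by (intro sum_mono le that)
    also have "\<dots> = h x * (\<Sum>m<n. c m)" by (simp add: sum_distrib_left)
    also have "\<dots> \<le> h x * suminf c" using c h0[OF that] by (intro mult_left_mono sum_le_suminf) auto
    finally show ?thesis .
  qed
  have conv: "(\<lambda>n. ?F n x) \<longlonglongrightarrow> ?G x" if "x \<in> S" for x
    using summable_LIMSEQ[OF sm[OF that]] .
  have h': "(\<lambda>x. h x * suminf c) integrable_on S"
    using h by (rule integrable_on_mult_left)
  have Fi: "?F n integrable_on S" for n using F by blast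
  have "?G integrable_on S" "(\<lambda>n. integral S (?F n)) \<longlonglongrightarrow> integral S ?G"
    using dominated_convergence[of ?F S "\<lambda>x. h x * suminf c" ?G, OF Fi h' bd conv] by auto
  moreover have "integral S (?F n) = (\<Sum>m<n. I m)" for n using F by (rule integral_unique)
  ultimately have "I sums integral S ?G" and G: "(?G has_integral integral S ?G) S"
    by (auto simp: sums_def)
  moreover have "J \<le> integral S ?G"
    using has_integral_le[OF L(1) G L(2)] .
  ultimately show ?thesis by (auto simp: sums_iff)
qed

section \<open>The fractional kernel as a mixture of exponentials\<close>

text \<open>Euler's integral after the rescaling t -> y t. With y = m + 1 - s the exponential splits
  off exp (-t) ^ m, which turns the kernel into a mixture of geometric sequences.\<close>

lemma has_integral_powr_exp:
  fixes \<alpha> y :: real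
  assumes \<alpha>: "0 < \<alpha>" and y: "0 < y"
  shows "((\<lambda>t. t powr (\<alpha> - 1) * exp (- (y * t))) has_integral (Gamma \<alpha> * y powr (- \<alpha>))) {0..}"
proof -
  let ?f = "\<lambda>t::real. t powr (\<alpha> - 1) / exp t"
  have img: "(\<lambda>t. y * t) ` {0..} = {0..}"
  proof
    show "{0..} \<subseteq> (\<lambda>t. y * t) ` {0..}"
    proof
      fix x :: real assume "x \<in> {0..}"
      then show "x \<in> (\<lambda>t. y * t) ` {0..}" using y by (intro image_eqI[of _ _ "x / y"]) auto
    qed
  qed (use y in auto)
  have "(?f has_integral Gamma \<alpha>) {0..}" by (rule Gamma_integral_real[OF \<alpha>])
  then have "?f absolutely_integrable_on {0..}" "integral {0..} ?f = Gamma \<alpha>"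
    by (auto intro!: nonnegative_absolutely_integrable_1 simp: integral_unique)
  then have "?f absolutely_integrable_on ((\<lambda>t. y * t) ` {0..}) \<and> integral ((\<lambda>t. y * t) ` {0..}) ?f = Gamma \<alpha>"
    by (simp add: img)
  moreover have "(\<lambda>t. \<bar>y\<bar> * ?f (y * t)) absolutely_integrable_on {0..} \<and>
      integral {0..} (\<lambda>t. \<bar>y\<bar> * ?f (y * t)) = Gamma \<alpha>
    \<longleftrightarrow> ?f absolutely_integrable_on ((\<lambda>t. y * t) ` {0..}) \<and> integral ((\<lambda>t. y * t) ` {0..}) ?f = Gamma \<alpha>"
    by (rule has_absolute_integral_change_of_variables_1'[where g' = "\<lambda>_. y"])
      (use y in \<open>auto intro!: derivative_eq_intros inj_onI\<close>)
  ultimately have "((\<lambda>t. \<bar>y\<bar> * ?f (y * t)) has_integral Gamma \<alpha>) {0..}"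
    by (metis (no_types, lifting) has_integral_integral set_lebesgue_integral_eq_integral(1))
  then have "((\<lambda>t. y powr (- \<alpha>) * (\<bar>y\<bar> * ?f (y * t))) has_integral (y powr (- \<alpha>) * Gamma \<alpha>)) {0..}"
    by (rule has_integral_mult_right)
  moreover have "y powr (- \<alpha>) * (\<bar>y\<bar> * ?f (y * t)) = t powr (\<alpha> - 1) * exp (- (y * t))" if "t \<in> {0..}" for t
  proof -
    have "y powr (- \<alpha>) * \<bar>y\<bar> * y powr (\<alpha> - 1) = y powr (- \<alpha>) * y powr 1 * y powr (\<alpha> - 1)"
      using y by simp
    also have "\<dots> = 1" using y by (simp only: powr_add[symmetric]) simp
    finally have "y powr (- \<alpha>) * \<bar>y\<bar> * y powr (\<alpha> - 1) = 1" .
    then have "y powr (- \<alpha>) * \<bar>y\<bar> * (y powr (\<alpha> - 1) * t powr (\<alpha> - 1)) = t powr (\<alpha> - 1)"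
      by (simp add: mult.assoc[symmetric])
    then show ?thesis using y that by (simp add: powr_mult exp_minus field_simps)
  qed
  ultimately show ?thesis
    by (subst (asm) has_integral_cong) (auto simp: mult.commute)
qed

text \<open>\<open>frac_kernel \<alpha> m s\<close> is the singular kernel on the \<open>m\<close>-th subinterval before the current
  time, in the local variable \<open>s \<in> [0,1]\<close>; the two moments weight a linear piece and its
  quadratic correction.\<close>
definition frac_kernel :: "real \<Rightarrow> nat \<Rightarrow> real \<Rightarrow> real" where
  "frac_kernel \<alpha> m s = (real m + 1 - s) powr (- \<alpha>)"

definition lin_moment :: "real \<Rightarrow> nat \<Rightarrow> real" where
  "lin_moment \<alpha> m = integral {0..1} (frac_kernel \<alpha> m)"

definition corr_moment :: "real \<Rightarrow> nat \<Rightarrow> real" where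
  "corr_moment \<alpha> m = integral {0..1} (\<lambda>s. (s - 1/2) * frac_kernel \<alpha> m s)"

lemma frac_kernel_nonneg: "0 \<le> frac_kernel \<alpha> m s"
  by (simp add: frac_kernel_def)

lemma frac_kernel_antimono:
  assumes "0 < \<alpha>" "m \<le> n" "s < 1"
  shows "frac_kernel \<alpha> n s \<le> frac_kernel \<alpha> m s"
  unfolding frac_kernel_def using assms by (intro powr_mono2') auto

lemma frac_kernel_mono:
  assumes "0 < \<alpha>" "s \<le> t" "t < 1"
  shows "frac_kernel \<alpha> m s \<le> frac_kernel \<alpha> m t"
  unfolding frac_kernel_def using assms by (intro powr_mono2') auto

text \<open>For m = 0 the kernel is singular at s = 1, but its antiderivative stays continuous there
  because \<alpha> < 1; hence the version of the fundamental theorem with derivatives only in the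
  interior.\<close>

lemma frac_kernel_has_integral:
  assumes "0 < \<alpha>" "\<alpha> < 1"
  shows "(frac_kernel \<alpha> m has_integral (((real m + 1) powr (1 - \<alpha>) - real m powr (1 - \<alpha>)) / (1 - \<alpha>))) {0..1}"
proof -
  let ?F = "\<lambda>s. - ((real m + 1 - s) powr (1 - \<alpha>)) / (1 - \<alpha>)"
  have "(frac_kernel \<alpha> m has_integral (?F 1 - ?F 0)) {0..1}"
  proof (rule fundamental_theorem_of_calculus_interior)
    show "continuous_on {0..1} ?F"
      using assms by (intro continuous_on_minus continuous_on_divide continuous_on_powr' continuous_intros) auto
    fix s :: real assume s: "s \<in> {0<..<1}"
    have "((\<lambda>s. (real m + 1 - s) powr (1 - \<alpha>)) has_real_derivative
        (1 - \<alpha>) * (real m + 1 - s) powr (1 - \<alpha> - 1) * (- 1)) (at s)"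
      by (rule DERIV_chain2[OF has_real_derivative_powr]) (use s in \<open>auto intro!: derivative_eq_intros\<close>)
    from DERIV_cdivide[OF DERIV_minus[OF this], of "1 - \<alpha>"]
    have "(?F has_real_derivative frac_kernel \<alpha> m s) (at s)"
      unfolding frac_kernel_def using assms by simp
    then show "(?F has_vector_derivative frac_kernel \<alpha> m s) (at s)"
      by (simp add: has_real_derivative_iff_has_vector_derivative)
  qed simp
  moreover have "?F 1 - ?F 0 = ((real m + 1) powr (1 - \<alpha>) - real m powr (1 - \<alpha>)) / (1 - \<alpha>)"
    by (simp add: diff_divide_distrib)
  ultimately show ?thesis by simp
qed

lemma frac_kernel_integral:
  assumes "0 < \<alpha>" "\<alpha> < 1"
  shows "(frac_kernel \<alpha> m has_integral lin_moment \<alpha> m) {0..1}"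
  unfolding lin_moment_def using frac_kernel_has_integral[OF assms] by blast

lemma corr_kernel_integral:
  assumes "0 < \<alpha>" "\<alpha> < 1"
  shows "((\<lambda>s. (s - 1/2) * frac_kernel \<alpha> m s) has_integral corr_moment \<alpha> m) {0..1}"
proof -
  have "continuous_on {0..1} (\<lambda>s. (real m + 1 - s) powr (1 - \<alpha>))"
    using assms by (intro continuous_on_powr' continuous_intros) auto
  then have "(\<lambda>s. (real m + 1 - s) powr (1 - \<alpha>)) integrable_on {0..1}"
    by (rule integrable_continuous_real)
  \<comment> \<open>Since s - 1/2 = (m + 1/2) - (m + 1 - s), the product is a multiple of the
    integrable kernel minus a continuous power.\<close>
  then have "(\<lambda>s. (real m + 1/2) * frac_kernel \<alpha> m s - (real m + 1 - s) powr (1 - \<alpha>)) integrable_on {0..1}"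
    using frac_kernel_integral[OF assms] by (intro integrable_diff integrable_on_mult_right) blast+
  moreover have "(real m + 1/2) * frac_kernel \<alpha> m s - (real m + 1 - s) powr (1 - \<alpha>) = (s - 1/2) * frac_kernel \<alpha> m s"
    if "s \<in> {0..1}" for s
  proof -
    \<comment> \<open>At the singular point m = 0, s = 1 both sides are 0, by the convention that
      \<open>powr\<close> has value 0 at base 0.\<close>
    have "(real m + 1 - s) powr (1 - \<alpha>) = (real m + 1 - s) * frac_kernel \<alpha> m s"
      using that by (cases "real m + 1 - s = 0") (auto simp: frac_kernel_def powr_diff powr_minus field_simps)
    then show ?thesis by (simp add: algebra_simps)
  qed
  ultimately have "(\<lambda>s. (s - 1/2) * frac_kernel \<alpha> m s) integrable_on {0..1}"
    by (rule integrable_eq)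
  then show ?thesis unfolding corr_moment_def by (rule integrable_integral)
qed

lemma has_integral_reflect_unit:
  fixes f :: "real \<Rightarrow> real"
  assumes "(f has_integral I) {0..1}"
  shows "((\<lambda>s. f (1 - s)) has_integral I) {0..1}"
proof -
  have *: "(\<lambda>x. - x + 1) ` {0..1} = {0..1::real}"
  proof
    show "{0..1} \<subseteq> (\<lambda>x. - x + 1) ` {0..1::real}"
    proof
      fix x :: real assume "x \<in> {0..1}"
      then show "x \<in> (\<lambda>x. - x + 1) ` {0..1}" by (intro image_eqI[of _ _ "1 - x"]) auto
    qed
  qed auto
  show ?thesis
    using has_integral_affinity[of f I 0 1 "-1" 1] assms by (simp add: * algebra_simps)
qed

section \<open>Symmetrisation about the midpoint of a subinterval\<close>

definition sym_kernel :: "real \<Rightarrow> nat \<Rightarrow> real \<Rightarrow> real" where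
  "sym_kernel \<alpha> m s = frac_kernel \<alpha> m s + frac_kernel \<alpha> m (1 - s)"

text \<open>Both factors change sign at s = 1/2 only, and in the same direction because the kernel
  increases in s; this is the source of nonnegativity on the open interval.\<close>

definition sym_corr_kernel :: "real \<Rightarrow> nat \<Rightarrow> real \<Rightarrow> real" where
  "sym_corr_kernel \<alpha> m s = (s - 1/2) * (frac_kernel \<alpha> m s - frac_kernel \<alpha> m (1 - s))"

text \<open>The endpoints are removed because there the value 0 of \<open>powr\<close> at base 0
  would break the monotonicity in \<open>m\<close> and in \<open>s\<close>; the integral does not
  see them.\<close>

lemma sym_kernel_integral:
  assumes "0 < \<alpha>" "\<alpha> < 1"
  shows "(sym_kernel \<alpha> m has_integral 2 * lin_moment \<alpha> m) {0<..<1}"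
proof -
  have "(sym_kernel \<alpha> m has_integral lin_moment \<alpha> m + lin_moment \<alpha> m) {0..1}"
    unfolding sym_kernel_def[abs_def]
    by (intro has_integral_add has_integral_reflect_unit frac_kernel_integral assms)
  then show ?thesis by (simp add: has_integral_Icc_iff_Ioo)
qed

lemma sym_corr_kernel_integral:
  assumes "0 < \<alpha>" "\<alpha> < 1"
  shows "(sym_corr_kernel \<alpha> m has_integral 2 * corr_moment \<alpha> m) {0<..<1}"
proof -
  have "((\<lambda>s. (s - 1/2) * frac_kernel \<alpha> m s + (1 - s - 1/2) * frac_kernel \<alpha> m (1 - s))
      has_integral corr_moment \<alpha> m + corr_moment \<alpha> m) {0..1}"
    using has_integral_reflect_unit[OF corr_kernel_integral[OF assms, of m]]
    by (intro has_integral_add corr_kernel_integral assms)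
  also have "(\<lambda>s. (s - 1/2) * frac_kernel \<alpha> m s + (1 - s - 1/2) * frac_kernel \<alpha> m (1 - s)) = sym_corr_kernel \<alpha> m"
    by (auto simp: sym_corr_kernel_def fun_eq_iff algebra_simps)
  finally show ?thesis by (simp add: has_integral_Icc_iff_Ioo)
qed

lemma sym_kernel_nonneg: "0 \<le> sym_kernel \<alpha> m s"
  by (simp add: sym_kernel_def frac_kernel_nonneg)

lemma sym_kernel_antimono:
  assumes "0 < \<alpha>" "m \<le> n" "0 < s" "s < 1"
  shows "sym_kernel \<alpha> n s \<le> sym_kernel \<alpha> m s"
  unfolding sym_kernel_def using assms by (intro add_mono frac_kernel_antimono) auto

lemma sym_corr_kernel_nonneg:
  assumes "0 < \<alpha>" "0 < s" "s < 1"
  shows "0 \<le> sym_corr_kernel \<alpha> m s"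
  unfolding sym_corr_kernel_def using assms frac_kernel_mono[of \<alpha> s "1 - s" m] frac_kernel_mono[of \<alpha> "1 - s" s m]
  by (cases "s \<ge> 1/2") (auto intro!: mult_nonneg_nonneg mult_nonpos_nonpos)

lemma abs_sym_corr_kernel_le:
  assumes "0 < s" "s < 1"
  shows "\<bar>sym_corr_kernel \<alpha> m s\<bar> \<le> sym_kernel \<alpha> m s"
proof -
  have "\<bar>sym_corr_kernel \<alpha> m s\<bar> = \<bar>s - 1/2\<bar> * \<bar>frac_kernel \<alpha> m s - frac_kernel \<alpha> m (1 - s)\<bar>"
    by (simp add: sym_corr_kernel_def abs_mult)
  also have "\<dots> \<le> 1 * sym_kernel \<alpha> m s"
    unfolding sym_kernel_def using assms frac_kernel_nonneg[of \<alpha> m s] frac_kernel_nonneg[of \<alpha> m "1 - s"]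
    by (intro mult_mono) auto
  finally show ?thesis by simp
qed

text \<open>Of s and 1 - s, the one that is at least 1/2 already contributes (1/2)^(-\<alpha>) - 1 =
  2^\<alpha> - 1, and the other contributes a nonnegative amount. This uniform drop is the source of
  the positive constant.\<close>

lemma sym_kernel_drop:
  assumes \<alpha>: "0 < \<alpha>" and s: "0 < s" "s < 1"
  shows "2 powr \<alpha> - 1 \<le> sym_kernel \<alpha> 0 s - sym_kernel \<alpha> 1 s"
proof -
  have "2 powr \<alpha> - 1 \<le> frac_kernel \<alpha> 0 u - frac_kernel \<alpha> 1 u" if "1/2 \<le> u" "u < 1" for u
  proof -
    have "(1/2) powr (- \<alpha>) \<le> (1 - u) powr (- \<alpha>)" using that \<alpha> by (intro powr_mono2') auto
    moreover have "(1/2) powr (- \<alpha>) = (2::real) powr \<alpha>" by (simp add: powr_minus powr_divide)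
    moreover have "(2 - u) powr (- \<alpha>) \<le> 1 powr (- \<alpha>)" using that \<alpha> by (intro powr_mono2') auto
    ultimately show ?thesis by (simp add: frac_kernel_def)
  qed
  from this[of s] this[of "1 - s"] show ?thesis
    using frac_kernel_antimono[of \<alpha> 0 1 s] frac_kernel_antimono[of \<alpha> 0 1 "1 - s"] assms
    by (cases "1/2 \<le> s") (auto simp: sym_kernel_def)
qed

section \<open>Integrating the geometric bound\<close>

text \<open>The geometric bound with r = exp (-t) is integrated against t^(\<alpha> - 1). Every
  kernel value then appears with the factor \<open>Gamma \<alpha>\<close>, which cancels at the
  end.\<close>

lemma sym_kernel_series_lower_bound:
  assumes \<xi>: "norm \<xi> < 1" and \<alpha>: "0 < \<alpha>" and s: "0 < s" "s < 1"
  shows "(1 - \<bar>2 * s - 1\<bar>) * (1 - Re \<xi>) / 4 * (sym_kernel \<alpha> 0 s - sym_kernel \<alpha> 1 s)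
    \<le> (\<Sum>m. sym_kernel \<alpha> m s * diff_weight \<xi> m + sym_corr_kernel \<alpha> m s * corr_weight k i \<xi> m)"
proof -
  define g where "g y t = t powr (\<alpha> - 1) * exp (- (y * t))" for y t :: real
  have g: "(g y has_integral (Gamma \<alpha> * y powr (- \<alpha>))) {0..}" if "y > 0" for y
    unfolding g_def[abs_def] by (rule has_integral_powr_exp[OF \<alpha> that])
  define \<beta> where "\<beta> t = exp (- ((1 - s) * t)) + exp (- (s * t))" for t :: real
  define \<gamma> where "\<gamma> t = (s - 1/2) * (exp (- ((1 - s) * t)) - exp (- (s * t)))" for t :: real
  \<comment> \<open>\<open>\<eta>\<close> is the share of the first-difference term that the
    correction may consume: |a - b| \<le> a + b for the two exponentials gives
    \<open>2 * \<gamma> t \<le> \<eta> * \<beta> t\<close>.\<close>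
  define \<eta> where "\<eta> = \<bar>2 * s - 1\<bar>"
  define f where "f m t = t powr (\<alpha> - 1) * (exp (- t) ^ m * (\<beta> t * diff_weight \<xi> m + \<gamma> t * corr_weight k i \<xi> m))" for m t
  define c where "c m = \<bar>diff_weight \<xi> m\<bar> + \<bar>corr_weight k i \<xi> m\<bar>" for m
  have expm: "exp (- t) ^ m = exp (- (real m * t))" for m t
    by (simp add: exp_of_nat_mult[symmetric])
  have \<beta>pos: "\<beta> t \<ge> 0" for t by (simp add: \<beta>_def)
  have \<gamma>0: "0 \<le> \<gamma> t" if "t \<ge> 0" for t
  proof (cases "s \<ge> 1/2")
    case True
    then have "(1 - s) * t \<le> s * t" using that by (intro mult_right_mono) auto
    then show ?thesis using True by (simp add: \<gamma>_def)
  next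
    case False
    then have "s * t \<le> (1 - s) * t" using that by (intro mult_right_mono) auto
    then show ?thesis using False by (auto simp: \<gamma>_def intro!: mult_nonpos_nonpos)
  qed
  have \<gamma>\<beta>: "2 * \<gamma> t \<le> \<eta> * \<beta> t" for t
  proof -
    have "2 * \<gamma> t \<le> \<bar>2 * s - 1\<bar> * \<bar>exp (- ((1 - s) * t)) - exp (- (s * t))\<bar>"
      unfolding \<gamma>_def abs_mult[symmetric] by (rule order_trans[OF _ abs_ge_self]) (simp add: algebra_simps)
    moreover have "\<bar>a - b\<bar> \<le> a + b" if "a > 0" "b > 0" for a b :: real using that by (auto simp: abs_if)
    then have "\<bar>2 * s - 1\<bar> * \<bar>exp (- ((1 - s) * t)) - exp (- (s * t))\<bar> \<le> \<eta> * \<beta> t"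
      unfolding \<eta>_def \<beta>_def by (intro mult_left_mono) auto
    ultimately show ?thesis by linarith
  qed
  have \<eta>1: "\<eta> \<le> 1" using s by (auto simp: \<eta>_def)
  have fint: "(f m has_integral (Gamma \<alpha> * (sym_kernel \<alpha> m s * diff_weight \<xi> m + sym_corr_kernel \<alpha> m s * corr_weight k i \<xi> m))) {0..}" for m
  proof -
    have "((\<lambda>t. diff_weight \<xi> m * (g (real m + 1 - s) t + g (real m + 1 - (1 - s)) t)
        + (s - 1/2) * corr_weight k i \<xi> m * (g (real m + 1 - s) t - g (real m + 1 - (1 - s)) t)) has_integral
        diff_weight \<xi> m * (Gamma \<alpha> * frac_kernel \<alpha> m s + Gamma \<alpha> * frac_kernel \<alpha> m (1 - s))
        + (s - 1/2) * corr_weight k i \<xi> m * (Gamma \<alpha> * frac_kernel \<alpha> m s - Gamma \<alpha> * frac_kernel \<alpha> m (1 - s))) {0..}"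
      unfolding frac_kernel_def using s
      by (intro has_integral_add has_integral_diff has_integral_mult_right g) auto
    also have "(\<lambda>t. diff_weight \<xi> m * (g (real m + 1 - s) t + g (real m + 1 - (1 - s)) t)
        + (s - 1/2) * corr_weight k i \<xi> m * (g (real m + 1 - s) t - g (real m + 1 - (1 - s)) t)) = f m"
    proof
      fix t
      have "exp (- ((real m + 1 - s) * t)) = exp (- (real m * t)) * exp (- ((1 - s) * t))"
        "exp (- ((real m + 1 - (1 - s)) * t)) = exp (- (real m * t)) * exp (- (s * t))"
        by (simp_all add: exp_add[symmetric] algebra_simps)
      then show "diff_weight \<xi> m * (g (real m + 1 - s) t + g (real m + 1 - (1 - s)) t)
        + (s - 1/2) * corr_weight k i \<xi> m * (g (real m + 1 - s) t - g (real m + 1 - (1 - s)) t) = f m t"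
        unfolding g_def f_def \<beta>_def \<gamma>_def expm by (simp only:) (simp add: algebra_simps)
    qed
    finally show ?thesis
      by (simp add: sym_kernel_def sym_corr_kernel_def algebra_simps)
  qed
  \<comment> \<open>Multiplication by exp (-t) raises \<open>m\<close> by one in the exponential
    representation, so the factor 1 - exp (-t) integrates to the difference of the kernels for 0 and
    1.\<close>
  define L where "L t = (1 - \<eta>) * (1 - Re \<xi>) / 4 * (t powr (\<alpha> - 1) * (\<beta> t * (1 - exp (- t))))" for t
  have Lint: "(L has_integral ((1 - \<eta>) * (1 - Re \<xi>) / 4 * (Gamma \<alpha> * (sym_kernel \<alpha> 0 s - sym_kernel \<alpha> 1 s)))) {0..}"
  proof -
    have "((\<lambda>t. (1 - \<eta>) * (1 - Re \<xi>) / 4 * ((g (1 - s) t + g s t) - (g (2 - s) t + g (1 + s) t))) has_integral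
      ((1 - \<eta>) * (1 - Re \<xi>) / 4 * ((Gamma \<alpha> * (1 - s) powr (-\<alpha>) + Gamma \<alpha> * s powr (-\<alpha>))
        - (Gamma \<alpha> * (2 - s) powr (-\<alpha>) + Gamma \<alpha> * (1 + s) powr (-\<alpha>))))) {0..}"
      using s by (intro has_integral_mult_right has_integral_add has_integral_diff g) auto
    also have "(\<lambda>t. (1 - \<eta>) * (1 - Re \<xi>) / 4 * ((g (1 - s) t + g s t) - (g (2 - s) t + g (1 + s) t))) = L"
    proof
      fix t
      have "exp (- ((2 - s) * t)) = exp (- ((1 - s) * t)) * exp (- t)"
        "exp (- ((1 + s) * t)) = exp (- (s * t)) * exp (- t)"
        by (simp_all add: exp_add[symmetric] algebra_simps)
      then show "(1 - \<eta>) * (1 - Re \<xi>) / 4 * ((g (1 - s) t + g s t) - (g (2 - s) t + g (1 + s) t)) = L t"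
        unfolding g_def L_def \<beta>_def by (simp add: algebra_simps)
    qed
    finally show ?thesis by (simp add: sym_kernel_def frac_kernel_def algebra_simps)
  qed
  have hint: "(\<lambda>t. t powr (\<alpha> - 1) * \<beta> t) integrable_on {0..}"
  proof -
    have "(\<lambda>t. g (1 - s) t + g s t) integrable_on {0..}"
      using g[of "1 - s"] g[of s] s by (intro integrable_add) auto
    then show ?thesis by (simp add: g_def \<beta>_def algebra_simps)
  qed
  have bound: "\<bar>f m t\<bar> \<le> t powr (\<alpha> - 1) * \<beta> t * c m" if "t \<in> {0..}" for m t
  proof -
    have "\<bar>\<gamma> t\<bar> \<le> \<beta> t"
      using \<gamma>0[of t] \<gamma>\<beta>[of t] that \<beta>pos[of t] mult_right_mono[OF \<eta>1 \<beta>pos[of t]] by auto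
    then have "\<bar>\<beta> t * diff_weight \<xi> m + \<gamma> t * corr_weight k i \<xi> m\<bar> \<le> \<beta> t * \<bar>diff_weight \<xi> m\<bar> + \<beta> t * \<bar>corr_weight k i \<xi> m\<bar>"
      using \<beta>pos[of t] by (intro order_trans[OF abs_triangle_ineq] add_mono) (auto simp: abs_mult intro: mult_right_mono)
    then have 1: "\<bar>\<beta> t * diff_weight \<xi> m + \<gamma> t * corr_weight k i \<xi> m\<bar> \<le> \<beta> t * c m"
      by (simp add: c_def algebra_simps)
    have "\<bar>f m t\<bar> = t powr (\<alpha> - 1) * (exp (- t) ^ m * \<bar>\<beta> t * diff_weight \<xi> m + \<gamma> t * corr_weight k i \<xi> m\<bar>)"
      by (simp add: f_def abs_mult)
    also have "\<dots> \<le> t powr (\<alpha> - 1) * (1 * (\<beta> t * c m))"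
      using that 1 by (intro mult_left_mono mult_mono) (auto intro: power_le_one)
    finally show ?thesis by (simp add: mult.assoc)
  qed
  have low: "L t \<le> (\<Sum>m. f m t)" if t: "t \<in> {0..}" for t
  proof -
    have r: "0 \<le> exp (- t)" "exp (- t) \<le> 1" using t by auto
    have sm: "summable (\<lambda>m. exp (- t) ^ m * (\<beta> t * diff_weight \<xi> m + \<gamma> t * corr_weight k i \<xi> m))"
    \<comment> \<open>At t = 0 the prefactor \<open>t powr (\<alpha> - 1)\<close> is 0 by
      convention, so the bound on \<open>f\<close> says nothing about the bracketed series; there
      the weights themselves are summed.\<close>
    proof (cases "t = 0")
      case True
      have "summable (\<lambda>m. diff_weight \<xi> m)" "summable (\<lambda>m. corr_weight k i \<xi> m)"
        by (rule summable_comparison_test'[OF summable_weights[OF \<xi>, of k i], of 0], simp)+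
      then show ?thesis using True by (auto intro!: summable_add summable_mult)
    next
      case False
      then have p: "t powr (\<alpha> - 1) > 0" by simp
      have "summable (\<lambda>m. t powr (\<alpha> - 1) * \<beta> t * c m)"
        using summable_weights[OF \<xi>, of k i] unfolding c_def by (intro summable_mult)
      then have "summable (\<lambda>m. f m t)"
        by (rule summable_comparison_test'[of _ 0]) (use bound[OF t] in auto)
      then show ?thesis using p unfolding f_def by (subst (asm) summable_cmult_iff) auto
    qed
    have "L t = t powr (\<alpha> - 1) * ((1 - \<eta>) * \<beta> t * ((1 - Re \<xi>) * (1 - exp (- t))) / 4)"
      by (simp add: L_def)
    also have "\<dots> \<le> t powr (\<alpha> - 1) * (\<Sum>m. exp (- t) ^ m * (\<beta> t * diff_weight \<xi> m + \<gamma> t * corr_weight k i \<xi> m))"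
      using \<xi> r \<gamma>0[of t] \<gamma>\<beta>[of t] \<eta>1 \<beta>pos[of t] t
      by (intro mult_left_mono geometric_kernel_lower_bound) auto
    also have "\<dots> = (\<Sum>m. f m t)" unfolding f_def using sm by (rule suminf_mult[symmetric])
    finally show ?thesis .
  qed
  have "summable (\<lambda>m. Gamma \<alpha> * (sym_kernel \<alpha> m s * diff_weight \<xi> m + sym_corr_kernel \<alpha> m s * corr_weight k i \<xi> m)) \<and>
    (1 - \<eta>) * (1 - Re \<xi>) / 4 * (Gamma \<alpha> * (sym_kernel \<alpha> 0 s - sym_kernel \<alpha> 1 s))
    \<le> (\<Sum>m. Gamma \<alpha> * (sym_kernel \<alpha> m s * diff_weight \<xi> m + sym_corr_kernel \<alpha> m s * corr_weight k i \<xi> m))"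
    by (rule has_integral_suminf_lower_bound[OF fint hint bound _ _ _ Lint low])
      (use \<beta>pos summable_weights[OF \<xi>, of k i] in \<open>auto simp: c_def[abs_def]\<close>)
  moreover have G: "Gamma \<alpha> > 0" using \<alpha> by (rule Gamma_real_pos)
  ultimately have "Gamma \<alpha> * ((1 - \<eta>) * (1 - Re \<xi>) / 4 * (sym_kernel \<alpha> 0 s - sym_kernel \<alpha> 1 s))
    \<le> Gamma \<alpha> * (\<Sum>m. sym_kernel \<alpha> m s * diff_weight \<xi> m + sym_corr_kernel \<alpha> m s * corr_weight k i \<xi> m)"
    by (subst suminf_mult[symmetric]) (auto simp: summable_cmult_iff mult_ac)
  then show ?thesis using G by (simp add: \<eta>_def)
qed

lemma moment_series_lower_bound:
  assumes \<xi>: "norm \<xi> < 1" and \<alpha>: "0 < \<alpha>" "\<alpha> < 1"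
  shows "summable (\<lambda>m. lin_moment \<alpha> m * diff_weight \<xi> m + corr_moment \<alpha> m * corr_weight k i \<xi> m) \<and>
    (2 powr \<alpha> - 1) / 24 * (1 - Re \<xi>)
    \<le> (\<Sum>m. lin_moment \<alpha> m * diff_weight \<xi> m + corr_moment \<alpha> m * corr_weight k i \<xi> m)"
proof -
  define f where "f m s = sym_kernel \<alpha> m s * diff_weight \<xi> m + sym_corr_kernel \<alpha> m s * corr_weight k i \<xi> m" for m s
  define c where "c m = \<bar>diff_weight \<xi> m\<bar> + \<bar>corr_weight k i \<xi> m\<bar>" for m
  \<comment> \<open>The factor 1/2 is 1/4 from the pointwise bound times 2 from 1 - |2s - 1| \<ge> 2
    s (1 - s). The integral 1/6 of s (1 - s) and the 2 in the symmetrised moments turn it into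
    1/24.\<close>
  define C where "C = (2 powr \<alpha> - 1) / 2 * (1 - Re \<xi>)"
  have x1: "Re \<xi> \<le> 1" using Re_sq_bounds(3)[of \<xi>] \<xi> by auto
  have p2: "(2::real) powr \<alpha> \<ge> 1" using \<alpha> by (intro ge_one_powr_ge_zero) auto
  have fint: "(f m has_integral (2 * lin_moment \<alpha> m * diff_weight \<xi> m + 2 * corr_moment \<alpha> m * corr_weight k i \<xi> m)) {0<..<1}" for m
    unfolding f_def[abs_def]
    by (intro has_integral_add has_integral_mult_left sym_kernel_integral sym_corr_kernel_integral \<alpha>)
  have bound: "\<bar>f m s\<bar> \<le> sym_kernel \<alpha> 0 s * c m" if "s \<in> {0<..<1}" for m s
  proof -
    have 1: "sym_kernel \<alpha> m s \<le> sym_kernel \<alpha> 0 s" using that \<alpha> by (intro sym_kernel_antimono) auto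
    have 2: "\<bar>sym_corr_kernel \<alpha> m s\<bar> \<le> sym_kernel \<alpha> 0 s" using abs_sym_corr_kernel_le[of s \<alpha> m] 1 that by auto
    have "\<bar>f m s\<bar> \<le> sym_kernel \<alpha> 0 s * \<bar>diff_weight \<xi> m\<bar> + sym_kernel \<alpha> 0 s * \<bar>corr_weight k i \<xi> m\<bar>"
      unfolding f_def using 1 2 sym_kernel_nonneg[of \<alpha> m s]
      by (intro order_trans[OF abs_triangle_ineq] add_mono) (auto simp: abs_mult intro: mult_right_mono)
    then show ?thesis by (simp add: c_def algebra_simps)
  qed
  have Lint: "((\<lambda>s. C * (s * (1 - s))) has_integral (C * (1/6))) {0<..<1}"
  proof -
    have "((\<lambda>s::real. s * (1 - s)) has_integral ((1^2/2 - 1^3/3) - (0^2/2 - 0^3/3))) {0..1}"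
      by (intro fundamental_theorem_of_calculus)
        (auto intro!: derivative_eq_intros simp: has_real_derivative_iff_has_vector_derivative[symmetric] algebra_simps power2_eq_square)
    then show ?thesis unfolding has_integral_Icc_iff_Ioo[symmetric] by (intro has_integral_mult_right) simp
  qed
  have low: "C * (s * (1 - s)) \<le> (\<Sum>m. f m s)" if s: "s \<in> {0<..<1}" for s
  proof -
    \<comment> \<open>1 - |2s - 1| is twice the minimum of s and 1 - s; the polynomial minorant has
      an elementary integral.\<close>
    have "s * (1 - s) \<le> s" "s * (1 - s) \<le> 1 - s" using s by (auto simp: mult_left_le mult_left_le_one_le)
    then have "2 * (s * (1 - s)) \<le> 1 - \<bar>2 * s - 1\<bar>" by auto
    then have "2 * (s * (1 - s)) * (2 powr \<alpha> - 1) \<le> (1 - \<bar>2 * s - 1\<bar>) * (sym_kernel \<alpha> 0 s - sym_kernel \<alpha> 1 s)"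
      using sym_kernel_drop[of \<alpha> s] s \<alpha> p2 by (intro mult_mono) auto
    then have "(1 - Re \<xi>) / 4 * (2 * (s * (1 - s)) * (2 powr \<alpha> - 1))
      \<le> (1 - Re \<xi>) / 4 * ((1 - \<bar>2 * s - 1\<bar>) * (sym_kernel \<alpha> 0 s - sym_kernel \<alpha> 1 s))"
      using x1 by (intro mult_left_mono) auto
    also have "\<dots> \<le> (\<Sum>m. f m s)"
      using sym_kernel_series_lower_bound[OF \<xi> \<alpha>(1), of s k i] s unfolding f_def by (simp add: mult_ac)
    also have "(1 - Re \<xi>) / 4 * (2 * (s * (1 - s)) * (2 powr \<alpha> - 1)) = C * (s * (1 - s))"
      by (simp add: C_def)
    finally show ?thesis .
  qed
  have "summable (\<lambda>m. 2 * lin_moment \<alpha> m * diff_weight \<xi> m + 2 * corr_moment \<alpha> m * corr_weight k i \<xi> m) \<and>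
    C * (1/6) \<le> (\<Sum>m. 2 * lin_moment \<alpha> m * diff_weight \<xi> m + 2 * corr_moment \<alpha> m * corr_weight k i \<xi> m)"
    by (rule has_integral_suminf_lower_bound[OF fint _ bound _ _ _ Lint low])
      (use sym_kernel_integral[OF \<alpha>, of 0] summable_weights[OF \<xi>, of k i] sym_kernel_nonneg in \<open>auto simp: c_def[abs_def]\<close>)
  then have "summable (\<lambda>m. 2 * (lin_moment \<alpha> m * diff_weight \<xi> m + corr_moment \<alpha> m * corr_weight k i \<xi> m)) \<and>
    C * (1/6) \<le> (\<Sum>m. 2 * (lin_moment \<alpha> m * diff_weight \<xi> m + corr_moment \<alpha> m * corr_weight k i \<xi> m))"
    by (simp add: algebra_simps)
  then have sm: "summable (\<lambda>m. lin_moment \<alpha> m * diff_weight \<xi> m + corr_moment \<alpha> m * corr_weight k i \<xi> m)"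
    and "C * (1/6) \<le> 2 * (\<Sum>m. lin_moment \<alpha> m * diff_weight \<xi> m + corr_moment \<alpha> m * corr_weight k i \<xi> m)"
    using summable_mult_D[of 2 "\<lambda>m. lin_moment \<alpha> m * diff_weight \<xi> m + corr_moment \<alpha> m * corr_weight k i \<xi> m"]
    by (simp_all only: suminf_mult zero_neq_numeral not_False_eq_True)
  then show ?thesis by (simp add: C_def field_simps)
qed

section \<open>The generating function of the weights\<close>

lemma lin_moment_nonneg:
  assumes "0 < \<alpha>" "\<alpha> < 1"
  shows "0 \<le> lin_moment \<alpha> m"
  using has_integral_nonneg[OF frac_kernel_integral[OF assms, of m]] frac_kernel_nonneg by auto

text \<open>The comparison uses the symmetrised integrals because they live on the open interval,
  where the kernels are ordered pointwise.\<close>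

lemma lin_moment_antimono:
  assumes "0 < \<alpha>" "\<alpha> < 1" "m \<le> n"
  shows "lin_moment \<alpha> n \<le> lin_moment \<alpha> m"
proof -
  have "2 * lin_moment \<alpha> n \<le> 2 * lin_moment \<alpha> m"
    by (rule has_integral_le[OF sym_kernel_integral sym_kernel_integral])
      (use assms in \<open>auto intro: sym_kernel_antimono\<close>)
  then show ?thesis by simp
qed

lemma frac_kernel_bounds:
  assumes "0 < \<alpha>" "0 < m" "s \<in> {0..1}"
  shows "(real m + 1) powr (- \<alpha>) \<le> frac_kernel \<alpha> m s" "frac_kernel \<alpha> m s \<le> real m powr (- \<alpha>)"
  unfolding frac_kernel_def using assms by (auto intro!: powr_mono2')

lemma powr_neg_tendsto_0:
  assumes "0 < \<alpha>"
  shows "(\<lambda>m. real m powr (- \<alpha>)) \<longlonglongrightarrow> 0"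
  using assms by (intro tendsto_neg_powr filterlim_real_sequentially) auto

lemma lin_moment_tendsto_0:
  assumes \<alpha>: "0 < \<alpha>" "\<alpha> < 1"
  shows "lin_moment \<alpha> \<longlonglongrightarrow> 0"
proof (rule tendsto_sandwich[OF _ _ tendsto_const powr_neg_tendsto_0[OF \<alpha>(1)]])
  show "eventually (\<lambda>m. 0 \<le> lin_moment \<alpha> m) sequentially"
    using lin_moment_nonneg[OF \<alpha>] by simp
  have "lin_moment \<alpha> m \<le> real m powr (- \<alpha>)" if "m > 0" for m
  proof -
    have "lin_moment \<alpha> m \<le> real m powr (- \<alpha>) * (1 - 0)"
      using has_integral_const_real[of "real m powr (- \<alpha>)" 0 1]
      by (intro has_integral_le[OF frac_kernel_integral[OF \<alpha>, of m]])
        (use \<alpha> that in \<open>auto intro!: frac_kernel_bounds\<close>)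
    then show ?thesis by simp
  qed
  then show "eventually (\<lambda>m. lin_moment \<alpha> m \<le> real m powr (- \<alpha>)) sequentially"
    by (intro eventually_mono[OF eventually_gt_at_top[of "0::nat"]]) auto
qed

lemma corr_moment_nonneg:
  assumes "0 < \<alpha>" "\<alpha> < 1"
  shows "0 \<le> corr_moment \<alpha> m"
  using has_integral_nonneg[OF sym_corr_kernel_integral[OF assms, of m]] sym_corr_kernel_nonneg assms by auto

text \<open>The factor s - 1/2 has mean zero, so only the oscillation of the kernel over one
  subinterval matters, and these oscillations telescope. The estimate starts at m = 1, since the
  kernel for m = 0 is unbounded.\<close>

lemma summable_corr_moment:
  assumes \<alpha>: "0 < \<alpha>" "\<alpha> < 1"
  shows "summable (corr_moment \<alpha>)"
proof (rule summable_comparison_test'[of _ 1])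
  show "summable (\<lambda>m. real m powr (- \<alpha>) - real (Suc m) powr (- \<alpha>))"
    by (rule telescope_summable'[OF powr_neg_tendsto_0[OF \<alpha>(1)]])
  fix m :: nat assume m: "m \<ge> 1"
  define B where "B = real m powr (- \<alpha>) - real (Suc m) powr (- \<alpha>)"
  have "2 * corr_moment \<alpha> m \<le> B * (1 - 0)"
  proof (rule has_integral_le[OF sym_corr_kernel_integral[OF \<alpha>, of m]])
    show "((\<lambda>s. B) has_integral B * (1 - 0)) {0<..<1::real}"
      using has_integral_const_real[of B 0 1] by (simp add: has_integral_Icc_iff_Ioo)
    fix s :: real assume s: "s \<in> {0<..<1}"
    have "\<bar>frac_kernel \<alpha> m s - frac_kernel \<alpha> m (1 - s)\<bar> \<le> B"
      using frac_kernel_bounds[of \<alpha> m s] frac_kernel_bounds[of \<alpha> m "1 - s"] s \<alpha> m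
      by (auto simp: B_def add.commute)
    then have "\<bar>s - 1/2\<bar> * \<bar>frac_kernel \<alpha> m s - frac_kernel \<alpha> m (1 - s)\<bar> \<le> 1 * B"
      using s by (intro mult_mono) auto
    then show "sym_corr_kernel \<alpha> m s \<le> B"
      unfolding sym_corr_kernel_def abs_mult[symmetric] by simp
  qed
  then show "norm (corr_moment \<alpha> m) \<le> real m powr (- \<alpha>) - real (Suc m) powr (- \<alpha>)"
    using corr_moment_nonneg[OF \<alpha>, of m] by (simp add: B_def)
qed

text \<open>Coefficients of \<open>(1 - x) \<Sum> f\<^sub>m x\<^sup>m\<close>.\<close>
definition bdiff :: "(nat \<Rightarrow> 'a::ab_group_add) \<Rightarrow> nat \<Rightarrow> 'a" where
  "bdiff f m = f m - (case m of 0 \<Rightarrow> 0 | Suc l \<Rightarrow> f l)"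

lemma bdiff_simps [simp]: "bdiff f 0 = f 0" "bdiff f (Suc m) = f (Suc m) - f m"
  by (simp_all add: bdiff_def)

section \<open>Differences of sequences and the convolution weights\<close>

lemma bdiff_sums_powser:
  fixes f :: "nat \<Rightarrow> 'a::real_normed_field"
  assumes "(\<lambda>m. f m * x ^ m) sums S"
  shows "(\<lambda>m. bdiff f m * x ^ m) sums ((1 - x) * S)"
proof -
  have "(\<lambda>m. x * (f m * x ^ m)) sums (x * S)" by (intro sums_mult assms)
  then have "(\<lambda>m. (case Suc m of 0 \<Rightarrow> 0 | Suc l \<Rightarrow> x * (f l * x ^ l))) sums (x * S)" by simp
  from sums_Suc[OF this] have "(\<lambda>m. (case m of 0 \<Rightarrow> 0 | Suc l \<Rightarrow> x * (f l * x ^ l))) sums (x * S)" by simp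
  from sums_diff[OF assms this]
  have "(\<lambda>m. f m * x ^ m - (case m of 0 \<Rightarrow> 0 | Suc l \<Rightarrow> x * (f l * x ^ l))) sums ((1 - x) * S)"
    by (simp add: algebra_simps)
  also have "(\<lambda>m. f m * x ^ m - (case m of 0 \<Rightarrow> 0 | Suc l \<Rightarrow> x * (f l * x ^ l))) = (\<lambda>m. bdiff f m * x ^ m)"
    by (auto simp: fun_eq_iff bdiff_def algebra_simps split: nat.split)
  finally show ?thesis .
qed

lemma sum_bdiff: "(\<Sum>m<Suc n. bdiff f m) = f n"
  by (induction n) auto

lemma bdiff_sums_0:
  fixes f :: "nat \<Rightarrow> 'a::real_normed_vector"
  assumes "f \<longlonglongrightarrow> 0"
  shows "bdiff f sums 0"
proof -
  have "(\<lambda>n. \<Sum>m<Suc n. bdiff f m) \<longlonglongrightarrow> 0" unfolding sum_bdiff by (rule assms)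
  then show ?thesis unfolding sums_def by (rule LIMSEQ_imp_Suc)
qed

lemma summable_norm_bdiff:
  fixes f :: "nat \<Rightarrow> real"
  assumes "summable (\<lambda>m. \<bar>f m\<bar>)"
  shows "summable (\<lambda>m. \<bar>bdiff f m\<bar>)"
proof -
  have "summable (\<lambda>m. \<bar>f (Suc m) - f m\<bar>)"
  proof (rule summable_comparison_test'[of _ 0])
    show "summable (\<lambda>m. \<bar>f (Suc m)\<bar> + \<bar>f m\<bar>)"
      using assms by (intro summable_add) (auto simp: summable_Suc_iff[of "\<lambda>m. \<bar>f m\<bar>"])
  qed auto
  then show ?thesis by (subst summable_Suc_iff[symmetric]) simp
qed

text \<open>The factor of the second difference at n - m. For \<open>(2,2)\<close> the subinterval
  before n - m looks one node ahead, which shifts the moment by one; the last second difference also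
  receives the moment of the last subinterval.\<close>

definition corr_seq :: "real \<Rightarrow> nat \<Rightarrow> nat \<Rightarrow> nat \<Rightarrow> real" where
  "corr_seq \<alpha> k i m = (if k = 1 then 0 else if i = 1 then corr_moment \<alpha> m
     else corr_moment \<alpha> (Suc m) + (if m = 0 then corr_moment \<alpha> 0 else 0))"

definition conv_weight :: "real \<Rightarrow> nat \<Rightarrow> nat \<Rightarrow> nat \<Rightarrow> real" where
  "conv_weight \<alpha> k i m = bdiff (lin_moment \<alpha>) m + bdiff (bdiff (corr_seq \<alpha> k i)) m"

lemma summable_corr_seq:
  assumes \<alpha>: "0 < \<alpha>" "\<alpha> < 1"
  shows "summable (\<lambda>m. \<bar>corr_seq \<alpha> k i m\<bar>)"
proof -
  have "\<bar>corr_seq \<alpha> k i m\<bar> = corr_seq \<alpha> k i m" for m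
    using corr_moment_nonneg[OF \<alpha>] by (auto simp: corr_seq_def)
  moreover have "summable (corr_seq \<alpha> k i)"
    unfolding corr_seq_def[abs_def] using summable_corr_moment[OF \<alpha>]
    by (cases "k = 1"; cases "i = 1") (auto intro!: summable_add simp: summable_Suc_iff)
  ultimately show ?thesis by simp
qed

lemma corr_seq_tendsto_0:
  assumes \<alpha>: "0 < \<alpha>" "\<alpha> < 1"
  shows "corr_seq \<alpha> k i \<longlonglongrightarrow> 0"
  using summable_LIMSEQ_zero[OF summable_rabs_cancel[OF summable_corr_seq[OF \<alpha>]]] .

text \<open>The linear moments decay like m^(-\<alpha>) and are not summable, but they decrease to
  0, so their differences telescope in absolute value. The correction part is a double difference of
  an absolutely summable sequence.\<close>

lemma summable_conv_weight:
  assumes \<alpha>: "0 < \<alpha>" "\<alpha> < 1"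
  shows "summable (\<lambda>m. \<bar>conv_weight \<alpha> k i m\<bar>)"
proof (rule summable_comparison_test'[of _ 0])
  have "summable (\<lambda>m. \<bar>bdiff (lin_moment \<alpha>) m\<bar>)"
  proof (subst summable_Suc_iff[symmetric])
    have "\<bar>bdiff (lin_moment \<alpha>) (Suc m)\<bar> = lin_moment \<alpha> m - lin_moment \<alpha> (Suc m)" for m
      using lin_moment_antimono[OF \<alpha>, of m "Suc m"] by simp
    then show "summable (\<lambda>m. \<bar>bdiff (lin_moment \<alpha>) (Suc m)\<bar>)"
      using telescope_summable'[OF lin_moment_tendsto_0[OF \<alpha>]] by simp
  qed
  then show "summable (\<lambda>m. \<bar>bdiff (lin_moment \<alpha>) m\<bar> + \<bar>bdiff (bdiff (corr_seq \<alpha> k i)) m\<bar>)"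
    using summable_norm_bdiff[OF summable_norm_bdiff[OF summable_corr_seq[OF \<alpha>]]] by (rule summable_add)
  show "norm \<bar>conv_weight \<alpha> k i n\<bar> \<le> \<bar>bdiff (lin_moment \<alpha>) n\<bar> + \<bar>bdiff (bdiff (corr_seq \<alpha> k i)) n\<bar>" for n
    by (simp add: conv_weight_def)
qed

text \<open>Both parts are differences of null sequences and telescope. This is the vanishing of the
  symbol at \<xi> = 1.\<close>

lemma conv_weight_sums_0:
  assumes \<alpha>: "0 < \<alpha>" "\<alpha> < 1"
  shows "conv_weight \<alpha> k i sums 0"
proof -
  have "bdiff (corr_seq \<alpha> k i) \<longlonglongrightarrow> 0"
    by (rule summable_LIMSEQ_zero[OF summable_rabs_cancel[OF summable_norm_bdiff[OF summable_corr_seq[OF \<alpha>]]]])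
  then have "(\<lambda>m. bdiff (lin_moment \<alpha>) m + bdiff (bdiff (corr_seq \<alpha> k i)) m) sums (0 + 0)"
    by (intro sums_add bdiff_sums_0 lin_moment_tendsto_0 \<alpha>)
  then show ?thesis by (simp add: conv_weight_def[abs_def])
qed

text \<open>Two groupings of one series: by second differences, as it arises in the weights, and by
  subintervals, as the positivity estimate needs it. For \<open>(2,2)\<close> they differ by an
  index shift with the term m = 0 set apart.\<close>

lemma corr_seq_sums:
  assumes \<alpha>: "0 < \<alpha>" "\<alpha> < 1" and \<xi>: "norm \<xi> < 1"
  shows "\<exists>S. (\<lambda>m. of_real (corr_seq \<alpha> k i m) * \<xi> ^ m) sums S \<and> (\<lambda>m. of_real (corr_moment \<alpha> m) * corr_power k i \<xi> m) sums S"
proof -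
  have sm: "summable (\<lambda>m. of_real (corr_moment \<alpha> (m + p)) * \<xi> ^ m)" for p
  proof (rule summable_norm_cancel, rule summable_comparison_test'[of _ 0])
    show "summable (\<lambda>m. corr_moment \<alpha> (m + p))"
      using summable_corr_moment[OF \<alpha>] by (simp add: summable_iff_shift)
    show "norm (norm (complex_of_real (corr_moment \<alpha> (n + p)) * \<xi> ^ n)) \<le> corr_moment \<alpha> (n + p)" for n
      using corr_moment_nonneg[OF \<alpha>, of "n + p"] \<xi> by (simp add: norm_mult norm_power mult_left_le power_le_one)
  qed
  consider "k = 1" | "k \<noteq> 1" "i = 1" | "k \<noteq> 1" "i \<noteq> 1" by blast
  then show ?thesis
  proof cases
    case 3
    from sm[of 1] obtain S where S: "(\<lambda>m. of_real (corr_moment \<alpha> (Suc m)) * \<xi> ^ m) sums S"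
      by (auto simp: summable_def)
    have "(\<lambda>m. if m = 0 then complex_of_real (corr_moment \<alpha> 0) else 0) sums of_real (corr_moment \<alpha> 0)"
      using sums_single[of 0 "\<lambda>_. complex_of_real (corr_moment \<alpha> 0)"] by simp
    from sums_add[OF S this]
    have "(\<lambda>m. of_real (corr_moment \<alpha> (Suc m)) * \<xi> ^ m + (if m = 0 then of_real (corr_moment \<alpha> 0) else 0))
      sums (S + of_real (corr_moment \<alpha> 0))" .
    also have "(\<lambda>m. of_real (corr_moment \<alpha> (Suc m)) * \<xi> ^ m + (if m = 0 then of_real (corr_moment \<alpha> 0) else 0))
      = (\<lambda>m. of_real (corr_seq \<alpha> k i m) * \<xi> ^ m)"
      using 3 by (auto simp: fun_eq_iff corr_seq_def)
    finally have "(\<lambda>m. of_real (corr_seq \<alpha> k i m) * \<xi> ^ m) sums (S + of_real (corr_moment \<alpha> 0))" .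
    moreover have "(\<lambda>m. of_real (corr_moment \<alpha> (Suc m)) * corr_power k i \<xi> (Suc m)) sums S"
      using S 3 by (simp add: corr_power_def)
    from sums_Suc[OF this] have "(\<lambda>m. of_real (corr_moment \<alpha> m) * corr_power k i \<xi> m) sums (S + of_real (corr_moment \<alpha> 0))"
      using 3 by (simp add: corr_power_def)
    ultimately show ?thesis by blast
  qed (use sm[of 0] in \<open>auto simp: corr_seq_def corr_power_def summable_def\<close>)
qed

lemma Re_conv_weight_ge:
  assumes \<alpha>: "0 < \<alpha>" "\<alpha> < 1" and \<xi>: "norm \<xi> < 1"
  shows "(2 powr \<alpha> - 1) / 24 * (1 - Re \<xi>) \<le> Re (\<Sum>m. of_real (conv_weight \<alpha> k i m) * \<xi> ^ m)"
proof -
  \<comment> \<open>Boundedness is all that the linear moments offer, so convergence comes from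
    |\<xi>| < 1.\<close>
  have "summable (\<lambda>m. complex_of_real (lin_moment \<alpha> m) * \<xi> ^ m)"
  proof (rule summable_norm_cancel, rule summable_comparison_test'[of _ 0])
    show "summable (\<lambda>m. lin_moment \<alpha> 0 * norm \<xi> ^ m)"
      using \<xi> by (intro summable_mult summable_geometric) auto
    show "norm (norm (complex_of_real (lin_moment \<alpha> n) * \<xi> ^ n)) \<le> lin_moment \<alpha> 0 * norm \<xi> ^ n" for n
      using lin_moment_nonneg[OF \<alpha>, of n] lin_moment_antimono[OF \<alpha>, of 0 n]
      by (simp add: norm_mult norm_power mult_right_mono)
  qed
  then obtain A where A: "(\<lambda>m. complex_of_real (lin_moment \<alpha> m) * \<xi> ^ m) sums A"
    by (auto simp: summable_def)
  obtain S where S: "(\<lambda>m. of_real (corr_seq \<alpha> k i m) * \<xi> ^ m) sums S"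
      "(\<lambda>m. of_real (corr_moment \<alpha> m) * corr_power k i \<xi> m) sums S"
    using corr_seq_sums[OF \<alpha> \<xi>] by blast
  have bd: "bdiff (\<lambda>m. complex_of_real (f m)) m = of_real (bdiff f m)" for f m
    by (cases m) auto
  have "(\<lambda>m. of_real (conv_weight \<alpha> k i m) * \<xi> ^ m) sums ((1 - \<xi>) * A + (1 - \<xi>) * ((1 - \<xi>) * S))"
    using sums_add[OF bdiff_sums_powser[OF A] bdiff_sums_powser[OF bdiff_sums_powser[OF S(1)]]]
    by (simp add: conv_weight_def bd algebra_simps)
  then have 1: "(\<Sum>m. of_real (conv_weight \<alpha> k i m) * \<xi> ^ m) = (1 - \<xi>) * A + (1 - \<xi>) * ((1 - \<xi>) * S)"
    by (simp add: sums_iff)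
  have "(\<lambda>m. (1 - \<xi>) * (of_real (lin_moment \<alpha> m) * \<xi> ^ m)
      + (1 - \<xi>)\<^sup>2 * (of_real (corr_moment \<alpha> m) * corr_power k i \<xi> m)) sums ((1 - \<xi>) * A + (1 - \<xi>)\<^sup>2 * S)"
    by (intro sums_add sums_mult A S)
  then have "(\<lambda>m. Re ((1 - \<xi>) * (of_real (lin_moment \<alpha> m) * \<xi> ^ m)
      + (1 - \<xi>)\<^sup>2 * (of_real (corr_moment \<alpha> m) * corr_power k i \<xi> m))) sums Re ((1 - \<xi>) * A + (1 - \<xi>)\<^sup>2 * S)"
    by (rule sums_Re)
  moreover have "Re ((1 - \<xi>) * (of_real (lin_moment \<alpha> m) * \<xi> ^ m)
      + (1 - \<xi>)\<^sup>2 * (of_real (corr_moment \<alpha> m) * corr_power k i \<xi> m))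
    = lin_moment \<alpha> m * diff_weight \<xi> m + corr_moment \<alpha> m * corr_weight k i \<xi> m" for m
  proof -
    have Rm: "Re (w * (of_real a * v)) = a * Re (w * v)" for a w v by (simp add: algebra_simps)
    show ?thesis by (simp only: plus_complex.sel Rm diff_weight_def corr_weight_def)
  qed
  ultimately have "(\<Sum>m. lin_moment \<alpha> m * diff_weight \<xi> m + corr_moment \<alpha> m * corr_weight k i \<xi> m)
      = Re ((1 - \<xi>) * A + (1 - \<xi>)\<^sup>2 * S)"
    by (simp add: sums_iff)
  also have "\<dots> = Re (\<Sum>m. of_real (conv_weight \<alpha> k i m) * \<xi> ^ m)"
    unfolding 1 by (simp only: power2_eq_square mult.assoc)
  finally show ?thesis using moment_series_lower_bound[OF \<xi> \<alpha>, of k i] by simp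
qed

section \<open>The discrete fractional derivative\<close>

text \<open>Backward differences. In the scheme \<open>dif1\<close> enters for l \<ge> 1 and
  \<open>dif2\<close> for l \<ge> 2, so no subtraction is truncated.\<close>

definition dif1 :: "(nat \<Rightarrow> complex) \<Rightarrow> nat \<Rightarrow> complex" where
  "dif1 u l = u l - u (l - 1)"

definition dif2 :: "(nat \<Rightarrow> complex) \<Rightarrow> nat \<Rightarrow> complex" where
  "dif2 u l = u l - 2 * u (l - 1) + u (l - 2)"

section \<open>Newton form of the pieces and their derivatives\<close>

lemma lagr_linear:
  assumes "dt \<noteq> 0"
  shows "lagr dt u (int a) 1 t = u a + of_real (t / dt - real a) * (u (a + 1) - u a)"
proof -
  have "{..Suc 0} = {0, Suc 0}" by auto
  moreover have "{0, Suc 0} - {0} = {Suc 0}" "{0, Suc 0} - {Suc 0} = {0}" by auto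
  moreover have "nat (int a + 1) = a + 1" by simp
  ultimately have "lagr dt u (int a) 1 t = u a * of_real ((t - (real a + 1) * dt) / (- dt)) + u (a + 1) * of_real ((t - real a * dt) / dt)"
    unfolding lagr_def by simp
  also have "of_real ((t - (real a + 1) * dt) / (- dt)) = 1 - complex_of_real (t / dt - real a)"
    using assms by (simp add: field_simps)
  also have "(t - real a * dt) / dt = t / dt - real a" using assms by (simp add: field_simps)
  finally show ?thesis by (simp add: algebra_simps)
qed

lemma lagr_quadratic:
  assumes "dt \<noteq> 0"
  shows "lagr dt u (int a) 2 t = u a + of_real (t / dt - real a) * (u (a + 1) - u a)
    + of_real ((t / dt - real a) * (t / dt - real a - 1) / 2) * dif2 u (a + 2)"
proof -
  define \<tau> where "\<tau> = t / dt - real a"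
  have t: "t = (\<tau> + real a) * dt" using assms by (simp add: \<tau>_def field_simps)
  have set2: "{..2::nat} = {0, 1, 2}" by auto
  have dif: "{0, Suc 0, 2} - {0} = {Suc 0, 2}" "{0, Suc 0, 2} - {Suc 0} = {0, 2}" "{0, Suc 0, 2} - {2} = {0, Suc 0}" by auto
  have na: "nat (int a + 1) = a + 1" "nat (int a + 2) = a + 2" by simp_all
  have "lagr dt u (int a) 2 t = u a * of_real ((\<tau> - 1) / (- 1) * ((\<tau> - 2) / (- 2)))
      + u (a + 1) * of_real (\<tau> * ((\<tau> - 2) / (- 1))) + u (a + 2) * of_real (\<tau> / 2 * (\<tau> - 1))"
  proof -
    have q: "(t - real_of_int (int a + int r) * dt) / ((real l - real r) * dt) = (\<tau> - real r) / (real l - real r)" for l r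
    proof -
      have "t - real_of_int (int a + int r) * dt = (\<tau> - real r) * dt" by (simp add: t algebra_simps)
      then show ?thesis using assms by simp
    qed
    show ?thesis unfolding lagr_def q set2
      by (simp add: dif na)
  qed
  also have "\<dots> = u a + of_real \<tau> * (u (a + 1) - u a) + of_real (\<tau> * (\<tau> - 1) / 2) * dif2 u (a + 2)"
    by (simp add: dif2_def field_simps)
  finally show ?thesis unfolding \<tau>_def .
qed

text \<open>For \<open>(2,1)\<close> the first piece is linear and every later one uses the node to
  its left. For \<open>(2,2)\<close> each piece looks one node ahead, except the last, where the
  next node lies beyond the current time.\<close>

definition piece_corr :: "nat \<Rightarrow> nat \<Rightarrow> nat \<Rightarrow> (nat \<Rightarrow> complex) \<Rightarrow> nat \<Rightarrow> complex" where
  "piece_corr k i n u l = (if k = 1 then 0 else if i = 1 then (if l = 1 then 0 else dif2 u l)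
     else if l < n then dif2 u (l + 1) else dif2 u l)"

text \<open>Both ends of the subinterval are always nodes, so the linear part is common to all
  cases. The third node only affects the coefficient of s (s - 1) / 2, which vanishes at both
  ends.\<close>

lemma piece_newton_form:
  assumes ki: "(k, i) \<in> {(1, 1), (2, 1), (2, 2)}" and n: "k \<le> n" and l: "1 \<le> l" "l \<le> n" and dt: "dt \<noteq> 0"
  shows "piece dt u k i n l \<xi> = u (l - 1) + of_real (\<xi> / dt - (real l - 1)) * dif1 u l
    + of_real ((\<xi> / dt - (real l - 1)) * (\<xi> / dt - (real l - 1) - 1) / 2) * piece_corr k i n u l"
proof -
  define s where "s = \<xi> / dt - (real l - 1)"
  have lin: "lagr dt u (int (l - 1)) 1 \<xi> = u (l - 1) + of_real s * dif1 u l"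
    using lagr_linear[OF dt, of u "l - 1" \<xi>] l by (simp add: dif1_def s_def of_nat_diff)
  have fwd: "lagr dt u (int (l - 1)) 2 \<xi> = u (l - 1) + of_real s * dif1 u l + of_real (s * (s - 1) / 2) * dif2 u (l + 1)"
    using lagr_quadratic[OF dt, of u "l - 1" \<xi>] l by (simp add: dif1_def s_def of_nat_diff)
  have bwd: "lagr dt u (int (l - 2)) 2 \<xi> = u (l - 1) + of_real s * dif1 u l + of_real (s * (s - 1) / 2) * dif2 u l"
    if "l \<ge> 2"
  proof -
    have e: "\<xi> / dt - real (l - 2) = s + 1" "l - 2 + 1 = l - 1" "l - 2 + 2 = l"
      using that by (simp_all add: s_def of_nat_diff)
    show ?thesis
      unfolding lagr_quadratic[OF dt, of u "l - 2" \<xi>] e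
      using that by (simp add: dif1_def dif2_def field_simps)
  qed
  consider "k = 1" "i = 1" | "k = 2" "i = 1" "l = 1" | "k = 2" "i = 1" "l \<ge> 2"
    | "k = 2" "i = 2" "l < n" | "k = 2" "i = 2" "l = n"
    using ki l by fastforce
  then show ?thesis
  proof cases
    case 1
    then show ?thesis using l lin by (simp add: piece_def interp_def piece_corr_def s_def of_nat_diff)
  next
    case 2
    then show ?thesis using l lin by (simp add: piece_def interp_def piece_corr_def s_def)
  next
    case 3
    then have "int l + 1 - int 2 - 1 = int (l - 2)" by simp
    then show ?thesis using 3 l bwd by (simp add: piece_def interp_def piece_corr_def s_def)
  next
    case 4
    then have "int l + 2 - int 2 - 1 = int (l - 1)" using l by simp
    then show ?thesis using 4 l fwd by (simp add: piece_def interp_def piece_corr_def s_def)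
  next
    case 5
    then have "int l + (int n + 1 - int l) - int 2 - 1 = int (l - 2)" using l n by simp
    then show ?thesis using 5 l n bwd by (simp add: piece_def interp_def piece_corr_def s_def)
  qed
qed

text \<open>The derivative of s (s - 1) / 2 is s - 1/2, the origin of that factor in
  \<open>corr_moment\<close>. The interval is open because the derivative may jump at grid
  points.\<close>

lemma PP_vector_derivative:
  assumes ki: "(k, i) \<in> {(1, 1), (2, 1), (2, 2)}" and n: "k \<le> n" and l: "1 \<le> l" "l \<le> n" and dt: "0 < dt"
    and \<xi>: "\<xi> \<in> {(real l - 1) * dt <..< real l * dt}"
  shows "vector_derivative (PP dt u k i n) (at \<xi>)
    = (dif1 u l + of_real (\<xi> / dt - (real l - 1) - 1/2) * piece_corr k i n u l) / of_real dt"
proof (rule vector_derivative_at)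
  let ?p = "\<lambda>\<xi>. u (l - 1) + of_real (\<xi> / dt - (real l - 1)) * dif1 u l
    + of_real ((\<xi> / dt - (real l - 1)) * (\<xi> / dt - (real l - 1) - 1) / 2) * piece_corr k i n u l"
  let ?S = "{(real l - 1) * dt <..< real l * dt}"
  have d: "((\<lambda>\<xi>. \<xi> / dt - (real l - 1)) has_real_derivative (1 / dt)) (at \<xi>)"
    "((\<lambda>\<xi>. (\<xi> / dt - (real l - 1)) * (\<xi> / dt - (real l - 1) - 1) / 2) has_real_derivative
      ((\<xi> / dt - (real l - 1) - 1/2) / dt)) (at \<xi>)"
    using dt by (auto intro!: derivative_eq_intros simp: field_simps)
  have d': "((\<lambda>\<xi>. complex_of_real (\<xi> / dt - (real l - 1))) has_vector_derivative of_real (1 / dt)) (at \<xi>)"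
    "((\<lambda>\<xi>. complex_of_real ((\<xi> / dt - (real l - 1)) * (\<xi> / dt - (real l - 1) - 1) / 2)) has_vector_derivative
      of_real ((\<xi> / dt - (real l - 1) - 1/2) / dt)) (at \<xi>)"
    by (intro has_vector_derivative_of_real d)+
  have "(?p has_vector_derivative (0 + of_real (1 / dt) * dif1 u l
      + of_real ((\<xi> / dt - (real l - 1) - 1/2) / dt) * piece_corr k i n u l)) (at \<xi>)"
    by (intro has_vector_derivative_add has_vector_derivative_mult_left has_vector_derivative_const d')
  also have "0 + of_real (1 / dt) * dif1 u l + of_real ((\<xi> / dt - (real l - 1) - 1/2) / dt) * piece_corr k i n u l
    = (dif1 u l + of_real (\<xi> / dt - (real l - 1) - 1/2) * piece_corr k i n u l) / of_real dt"
    by (simp only: of_real_divide of_real_1 add_divide_distrib times_divide_eq_left mult_1 add_0)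
  finally show "(PP dt u k i n has_vector_derivative
    (dif1 u l + of_real (\<xi> / dt - (real l - 1) - 1/2) * piece_corr k i n u l) / of_real dt) (at \<xi>)"
  proof (rule has_vector_derivative_transform_within_open[of _ _ _ ?S])
    fix y assume y: "y \<in> ?S"
    have "\<lceil>y / dt\<rceil> = int l"
      using y dt by (intro ceiling_unique) (auto simp: field_simps)
    then have "max 1 (nat \<lceil>y / dt\<rceil>) = l" using l by simp
    then show "?p y = PP dt u k i n y"
      unfolding PP_def using piece_newton_form[OF ki n l, of dt u y] dt by simp
  qed (use \<xi> in auto)
qed

section \<open>The scheme as a convolution of differences\<close>

text \<open>Under s = \<xi> / dt - (l - 1) the distance to the current time becomes dt (n - l + 1 -
  s). The Jacobian dt cancels the 1 / dt of the derivative, leaving the scaling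
  dt^(-\<alpha>).\<close>

lemma subinterval_integral:
  assumes ki: "(k, i) \<in> {(1, 1), (2, 1), (2, 2)}" and n: "k \<le> n" and l: "1 \<le> l" "l \<le> n" and dt: "0 < dt"
    and \<alpha>: "0 < \<alpha>" "\<alpha> < 1"
  shows "((\<lambda>\<xi>. complex_of_real ((real n * dt - \<xi>) powr (- \<alpha>)) * vector_derivative (PP dt u k i n) (at \<xi>))
    has_integral of_real (dt powr (- \<alpha>)) * (of_real (lin_moment \<alpha> (n - l)) * dif1 u l
      + of_real (corr_moment \<alpha> (n - l)) * piece_corr k i n u l)) {(real l - 1) * dt .. real l * dt}"
proof -
  define V where "V = of_real (lin_moment \<alpha> (n - l)) * dif1 u l + of_real (corr_moment \<alpha> (n - l)) * piece_corr k i n u l"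
  define g where "g s = complex_of_real (frac_kernel \<alpha> (n - l) s) * dif1 u l
    + of_real ((s - 1/2) * frac_kernel \<alpha> (n - l) s) * piece_corr k i n u l" for s
  have "(g has_integral V) {0..1}"
    unfolding g_def[abs_def] V_def
    by (intro has_integral_add has_integral_mult_left has_integral_of_real frac_kernel_integral corr_kernel_integral \<alpha>)
  then have "((\<lambda>\<xi>. g ((1 / dt) *\<^sub>R \<xi> + - (real l - 1))) has_integral V /\<^sub>R (1 / dt) ^ DIM(real))
      (cbox ((0 - - (real l - 1)) /\<^sub>R (1 / dt)) ((1 - - (real l - 1)) /\<^sub>R (1 / dt)))"
    using dt by (intro has_integral_affinity') auto
  then have "((\<lambda>\<xi>. g (\<xi> / dt - (real l - 1))) has_integral of_real dt * V) {(real l - 1) * dt .. real l * dt}"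
    using dt by (simp add: scaleR_conv_of_real divide_inverse mult.commute flip: diff_conv_add_uminus) (simp add: diff_diff_eq2 add_diff_eq)
  then have "((\<lambda>\<xi>. of_real (dt powr (- \<alpha>) / dt) * g (\<xi> / dt - (real l - 1))) has_integral
      of_real (dt powr (- \<alpha>) / dt) * (of_real dt * V)) {(real l - 1) * dt .. real l * dt}"
    by (rule has_integral_mult_right)
  also have "of_real (dt powr (- \<alpha>) / dt) * (of_real dt * V) = of_real (dt powr (- \<alpha>)) * V"
    using dt by simp
  finally have "((\<lambda>\<xi>. of_real (dt powr (- \<alpha>) / dt) * g (\<xi> / dt - (real l - 1))) has_integral
      of_real (dt powr (- \<alpha>)) * V) {(real l - 1) * dt <..< real l * dt}"
    by (simp add: has_integral_Icc_iff_Ioo)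
  moreover have "of_real (dt powr (- \<alpha>) / dt) * g (\<xi> / dt - (real l - 1))
      = complex_of_real ((real n * dt - \<xi>) powr (- \<alpha>)) * vector_derivative (PP dt u k i n) (at \<xi>)"
    if \<xi>: "\<xi> \<in> {(real l - 1) * dt <..< real l * dt}" for \<xi>
  proof -
    have le: "real l * dt \<le> real n * dt" using l dt by simp
    have "real (n - l) + 1 - (\<xi> / dt - (real l - 1)) = (real n * dt - \<xi>) / dt"
      using dt l by (simp add: of_nat_diff field_simps)
    then have "dt powr (- \<alpha>) * frac_kernel \<alpha> (n - l) (\<xi> / dt - (real l - 1)) = dt powr (- \<alpha>) * ((real n * dt - \<xi>) / dt) powr (- \<alpha>)"
      by (simp add: frac_kernel_def)
    also have "\<dots> = (real n * dt - \<xi>) powr (- \<alpha>)"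
      using dt \<xi> le by (simp add: powr_divide)
    finally have K: "dt powr (- \<alpha>) * frac_kernel \<alpha> (n - l) (\<xi> / dt - (real l - 1)) = (real n * dt - \<xi>) powr (- \<alpha>)" .
    show ?thesis
      unfolding PP_vector_derivative[OF ki n l dt \<xi>] K[symmetric] g_def using dt
      by (simp add: field_simps)
  qed
  ultimately show ?thesis
    unfolding has_integral_Icc_iff_Ioo V_def by (subst (asm) has_integral_cong) auto
qed

lemma fracD_moments:
  assumes ki: "(k, i) \<in> {(1, 1), (2, 1), (2, 2)}" and n: "k \<le> n" and dt: "0 < dt"
    and \<alpha>: "0 < \<alpha>" "\<alpha> < 1"
  shows "of_real (dt powr \<alpha>) * fracD dt \<alpha> k i u n = of_real (1 / Gamma (1 - \<alpha>)) *
    (\<Sum>l=1..n. of_real (lin_moment \<alpha> (n - l)) * dif1 u l + of_real (corr_moment \<alpha> (n - l)) * piece_corr k i n u l)"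
proof -
  let ?f = "\<lambda>\<xi>. complex_of_real ((real n * dt - \<xi>) powr (- \<alpha>)) * vector_derivative (PP dt u k i n) (at \<xi>)"
  let ?V = "\<lambda>l. of_real (lin_moment \<alpha> (n - l)) * dif1 u l + of_real (corr_moment \<alpha> (n - l)) * piece_corr k i n u l"
  have "(?f has_integral (\<Sum>l=1..p. of_real (dt powr (- \<alpha>)) * ?V l)) {0 .. real p * dt}" if "p \<le> n" for p
    using that
  proof (induction p)
    case 0
    show ?case using has_integral_refl(2)[of ?f 0] by simp
  next
    case (Suc p)
    have "(?f has_integral (\<Sum>l=1..p. of_real (dt powr (- \<alpha>)) * ?V l) + of_real (dt powr (- \<alpha>)) * ?V (Suc p)) {0 .. real (Suc p) * dt}"
    proof (rule has_integral_combine)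
      show "(?f has_integral (\<Sum>l=1..p. of_real (dt powr (- \<alpha>)) * ?V l)) {0 .. real p * dt}"
        using Suc by simp
      show "(?f has_integral of_real (dt powr (- \<alpha>)) * ?V (Suc p)) {real p * dt .. real (Suc p) * dt}"
        using subinterval_integral[OF ki n _ _ dt \<alpha>, of "Suc p" u] Suc.prems by simp
    qed (use dt in auto)
    then show ?case by simp
  qed
  from integral_unique[OF this[of n]]
  have "fracD dt \<alpha> k i u n = of_real (1 / Gamma (1 - \<alpha>)) * (of_real (dt powr (- \<alpha>)) * (\<Sum>l=1..n. ?V l))"
    unfolding fracD_def by (simp only: sum_distrib_left order_refl)
  moreover have "complex_of_real (dt powr \<alpha>) * of_real (dt powr (- \<alpha>)) = 1"
    using dt unfolding of_real_mult[symmetric] powr_add[symmetric] by simp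
  ultimately show ?thesis by (metis (no_types, lifting) mult.left_commute mult.right_neutral mult.assoc)
qed

lemma fracD_formula:
  assumes ki: "(k, i) \<in> {(1, 1), (2, 1), (2, 2)}" and n: "k \<le> n" and dt: "0 < dt"
    and \<alpha>: "0 < \<alpha>" "\<alpha> < 1"
  shows "of_real (dt powr \<alpha>) * fracD dt \<alpha> k i u n = of_real (1 / Gamma (1 - \<alpha>)) *
    ((\<Sum>l=1..n. of_real (lin_moment \<alpha> (n - l)) * dif1 u l) + (\<Sum>l=2..n. of_real (corr_seq \<alpha> k i (n - l)) * dif2 u l))"
proof -
  have "(\<Sum>l=1..n. of_real (corr_moment \<alpha> (n - l)) * piece_corr k i n u l) = (\<Sum>l=2..n. of_real (corr_seq \<alpha> k i (n - l)) * dif2 u l)"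
  proof -
    consider "k = 1" | "k = 2" "i = 1" | "k = 2" "i = 2" using ki by auto
    then show ?thesis
    proof cases
      case 1
      then show ?thesis by (simp add: piece_corr_def corr_seq_def)
    next
      case 2
      then have "{1..n} = insert 1 {2..n}" using n by auto
      then show ?thesis using 2 by (simp add: piece_corr_def corr_seq_def)
    next
      \<comment> \<open>Pieces l < n carry the second difference at l + 1, so the index is shifted;
        the one at n occurs twice, from the last two pieces, which explains the extra term of
        \<open>corr_seq\<close> at 0.\<close>
      case 3
      then obtain p where p: "n = Suc p" "p \<ge> 1" using n by (cases n) auto
      have "(\<Sum>l=1..n. of_real (corr_moment \<alpha> (n - l)) * piece_corr k i n u l)
          = (\<Sum>l=1..p. of_real (corr_moment \<alpha> (n - l)) * dif2 u (Suc l)) + of_real (corr_moment \<alpha> 0) * dif2 u n"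
        using 3 p by (simp add: piece_corr_def)
      also have "(\<Sum>l=1..p. of_real (corr_moment \<alpha> (n - l)) * dif2 u (Suc l))
          = (\<Sum>l=Suc 1..Suc p. of_real (corr_moment \<alpha> (Suc n - l)) * dif2 u l)"
        by (subst sum.shift_bounds_cl_Suc_ivl) simp
      also have "\<dots> + of_real (corr_moment \<alpha> 0) * dif2 u n
          = (\<Sum>l=2..n. of_real (corr_moment \<alpha> (Suc n - l)) * dif2 u l) + (\<Sum>l=2..n. if l = n then of_real (corr_moment \<alpha> 0) * dif2 u n else 0)"
        using 3 n p by (simp add: numeral_2_eq_2)
      also have "\<dots> = (\<Sum>l=2..n. of_real (corr_seq \<alpha> k i (n - l)) * dif2 u l)"
        unfolding sum.distrib[symmetric] using 3
        by (intro sum.cong) (auto simp: corr_seq_def Suc_diff_le algebra_simps)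
      finally show ?thesis .
    qed
  qed
  then show ?thesis unfolding fracD_moments[OF assms] sum.distrib by simp
qed

section \<open>Stability\<close>

text \<open>Summation by parts: the difference moves from the unit sequence to the weights. The
  bound 1 \<le> j keeps the term l = j inside the sum; second differences need 2 \<le> j for the
  same reason.\<close>

lemma sum_dif1_unit:
  fixes a :: "nat \<Rightarrow> complex"
  assumes "1 \<le> j" "j \<le> n"
  shows "(\<Sum>l=1..n. a (n - l) * dif1 (\<lambda>l. if l = j then 1 else 0) l) = bdiff a (n - j)"
proof -
  have "(\<Sum>l=1..n. a (n - l) * dif1 (\<lambda>l. if l = j then 1 else 0) l)
      = (\<Sum>l=1..n. (if l = j then a (n - l) else 0) - (if l = Suc j then a (n - l) else 0))"
    by (intro sum.cong) (auto simp: dif1_def)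
  also have "\<dots> = a (n - j) - (if Suc j \<le> n then a (n - Suc j) else 0)"
    using assms by (simp add: sum_subtractf sum.delta)
  also have "\<dots> = bdiff a (n - j)"
    by (cases "n - j") (auto simp: Suc_le_eq diff_Suc)
  finally show ?thesis .
qed

lemma sum_dif2_unit:
  fixes a :: "nat \<Rightarrow> complex"
  assumes "2 \<le> j" "j \<le> n"
  shows "(\<Sum>l=2..n. a (n - l) * dif2 (\<lambda>l. if l = j then 1 else 0) l) = bdiff (bdiff a) (n - j)"
proof -
  have "(\<Sum>l=2..n. a (n - l) * dif2 (\<lambda>l. if l = j then 1 else 0) l)
      = (\<Sum>l=2..n. (if l = j then a (n - l) else 0) - (if l = Suc j then 2 * a (n - l) else 0)
        + (if l = Suc (Suc j) then a (n - l) else 0))"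
  proof (intro sum.cong refl)
    fix l assume "l \<in> {2..n}"
    then have "l - 1 = j \<longleftrightarrow> l = Suc j" "l - 2 = j \<longleftrightarrow> l = Suc (Suc j)" by auto
    then show "a (n - l) * dif2 (\<lambda>l. if l = j then 1 else 0) l
      = (if l = j then a (n - l) else 0) - (if l = Suc j then 2 * a (n - l) else 0)
        + (if l = Suc (Suc j) then a (n - l) else 0)"
      by (simp add: dif2_def)
  qed
  also have "\<dots> = a (n - j) - (if Suc j \<le> n then 2 * a (n - Suc j) else 0)
      + (if Suc (Suc j) \<le> n then a (n - Suc (Suc j)) else 0)"
    using assms by (simp add: sum_subtractf sum.distrib sum.delta)
  also have "\<dots> = bdiff (bdiff a) (n - j)"
  proof -
    consider "n = j" | "n = Suc j" | p where "n = Suc (Suc (j + p))"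
      using assms by (metis add_Suc le_Suc_ex add_0_right add_Suc_right not0_implies_Suc)
    then show ?thesis by cases (auto simp: Suc_diff_le)
  qed
  finally show ?thesis .
qed

lemma bdiff_of_real: "bdiff (\<lambda>m. complex_of_real (f m)) = (\<lambda>m. of_real (bdiff f m))"
  by (auto simp: fun_eq_iff bdiff_def split: nat.split)

lemma omega_eq:
  assumes ki: "(k, i) \<in> {(1, 1), (2, 1), (2, 2)}" and dt: "0 < dt" and \<alpha>: "0 < \<alpha>" "\<alpha> < 1"
  shows "omega dt \<alpha> k i m = of_real (conv_weight \<alpha> k i m / Gamma (1 - \<alpha>))"
proof -
  let ?e = "\<lambda>l. if l = k then 1 else (0::complex)"
  have k: "1 \<le> k" using ki by auto
  have 1: "(\<Sum>l=1..m+k. of_real (lin_moment \<alpha> (m + k - l)) * dif1 ?e l) = complex_of_real (bdiff (lin_moment \<alpha>) m)"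
    using sum_dif1_unit[of k "m + k" "\<lambda>m. of_real (lin_moment \<alpha> m)"] k by (simp add: bdiff_of_real)
  have 2: "(\<Sum>l=2..m+k. of_real (corr_seq \<alpha> k i (m + k - l)) * dif2 ?e l) = complex_of_real (bdiff (bdiff (corr_seq \<alpha> k i)) m)"
  \<comment> \<open>For k = 1 the unit sits at index 1, outside the range of the second-difference
    formula, but then there is no correction.\<close>
  proof (cases "k = 1")
    case True
    have "corr_seq \<alpha> k i = (\<lambda>_. 0)" using True by (auto simp: corr_seq_def)
    then show ?thesis by (simp add: bdiff_def split: nat.split)
  next
    case False
    then show ?thesis
      using sum_dif2_unit[of k "m + k" "\<lambda>m. of_real (corr_seq \<alpha> k i m)"] ki by (auto simp: bdiff_of_real)
  qed
  show ?thesis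
    unfolding omega_def coef_def
    by (subst fracD_formula[OF ki _ dt \<alpha>]) (simp, simp only: 1 2 conv_weight_def, simp)
qed

lemma sum_conv_finite_support_tendsto_0:
  fixes a x :: "nat \<Rightarrow> complex"
  assumes a: "a \<longlonglongrightarrow> 0" and x: "\<And>l. l > L \<Longrightarrow> x l = 0"
  shows "(\<lambda>n. \<Sum>l=p..n. a (n - l) * x l) \<longlonglongrightarrow> 0"
proof -
  have "(\<lambda>n. \<Sum>l=p..L. a (n - l) * x l) \<longlonglongrightarrow> (\<Sum>l=p..L. 0 * x l)"
    by (intro tendsto_sum tendsto_mult tendsto_const seq_offset_neg a)
  moreover have "(\<Sum>l=p..L. a (n - l) * x l) = (\<Sum>l=p..n. a (n - l) * x l)" if "n \<ge> L" for n
    using that x by (intro sum.mono_neutral_left) auto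
  then have "eventually (\<lambda>n. (\<Sum>l=p..L. a (n - l) * x l) = (\<Sum>l=p..n. a (n - l) * x l)) sequentially"
    unfolding eventually_sequentially by blast
  ultimately have "(\<lambda>n. \<Sum>l=p..n. a (n - l) * x l) \<longlonglongrightarrow> (\<Sum>l=p..L. 0 * x l)"
    by (rule Lim_transform_eventually)
  then show ?thesis by simp
qed

text \<open>A single grid value enters only finitely many differences, and their weights fade as the
  current time moves away.\<close>

lemma coef_tendsto_0:
  assumes ki: "(k, i) \<in> {(1, 1), (2, 1), (2, 2)}" and dt: "0 < dt" and \<alpha>: "0 < \<alpha>" "\<alpha> < 1"
  shows "(\<lambda>n. coef dt \<alpha> k i n j) \<longlonglongrightarrow> 0"
proof -
  let ?e = "\<lambda>l. if l = j then 1 else (0::complex)"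
  let ?c = "\<lambda>n. of_real (1 / Gamma (1 - \<alpha>)) *
    ((\<Sum>l=1..n. of_real (lin_moment \<alpha> (n - l)) * dif1 ?e l) + (\<Sum>l=2..n. of_real (corr_seq \<alpha> k i (n - l)) * dif2 ?e l))"
  have lim: "(\<lambda>m. complex_of_real (f m)) \<longlonglongrightarrow> 0" if "f \<longlonglongrightarrow> 0" for f
    using tendsto_of_real[OF that, where ?'a = complex] by simp
  have "?c \<longlonglongrightarrow> of_real (1 / Gamma (1 - \<alpha>)) * (0 + 0)"
  proof (intro tendsto_mult tendsto_add tendsto_const)
    show "(\<lambda>n. \<Sum>l=1..n. of_real (lin_moment \<alpha> (n - l)) * dif1 ?e l) \<longlonglongrightarrow> 0"
      by (rule sum_conv_finite_support_tendsto_0[OF lim[OF lin_moment_tendsto_0[OF \<alpha>]], of "j + 2"])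
        (auto simp: dif1_def)
    show "(\<lambda>n. \<Sum>l=2..n. of_real (corr_seq \<alpha> k i (n - l)) * dif2 ?e l) \<longlonglongrightarrow> 0"
      by (rule sum_conv_finite_support_tendsto_0[OF lim[OF corr_seq_tendsto_0[OF \<alpha>]], of "j + 2"])
        (auto simp: dif2_def)
  qed
  then have "?c \<longlonglongrightarrow> 0" by simp
  moreover have "?c n = coef dt \<alpha> k i n j" if "k \<le> n" for n
    unfolding coef_def by (rule fracD_formula[OF ki that dt \<alpha>, symmetric])
  then have "eventually (\<lambda>n. ?c n = coef dt \<alpha> k i n j) sequentially"
    unfolding eventually_sequentially by blast
  ultimately show ?thesis by (rule Lim_transform_eventually)
qed

lemma omega_summable:
  assumes ki: "(k, i) \<in> {(1, 1), (2, 1), (2, 2)}" and dt: "0 < dt" and \<alpha>: "0 < \<alpha>" "\<alpha> < 1"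
  shows "summable (\<lambda>m. norm (omega dt \<alpha> k i m))"
proof -
  have "norm (omega dt \<alpha> k i m) = \<bar>conv_weight \<alpha> k i m\<bar> / \<bar>Gamma (1 - \<alpha>)\<bar>" for m
    unfolding omega_eq[OF assms] norm_of_real by simp
  then show ?thesis using summable_conv_weight[OF \<alpha>, of k i] by (simp add: summable_divide)
qed

lemma wst_tendsto_0:
  assumes ki: "(k, i) \<in> {(1, 1), (2, 1), (2, 2)}" and dt: "0 < dt" and \<alpha>: "0 < \<alpha>" "\<alpha> < 1"
  shows "(\<lambda>n. wst dt \<alpha> k i n j) \<longlonglongrightarrow> 0"
proof -
  have "omega dt \<alpha> k i \<longlonglongrightarrow> 0"
    using summable_LIMSEQ_zero[OF summable_norm_cancel[OF omega_summable[OF assms]]] .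
  then have "(\<lambda>n. coef dt \<alpha> k i n j - omega dt \<alpha> k i (n - j)) \<longlonglongrightarrow> 0 - 0"
    by (intro tendsto_diff coef_tendsto_0 assms seq_offset_neg)
  then show ?thesis by (simp add: wst_def)
qed

text \<open>Near 1, continuity of the symbol on the closed disc and its zero at 1 keep it below |z|
  / 2 in modulus. Elsewhere 1 - Re \<xi> is bounded below and Re z \<le> 0 can only increase the
  real part of the difference.\<close>

lemma symbol_lower_bound:
  assumes ki: "(k, i) \<in> {(1, 1), (2, 1), (2, 2)}" and dt: "0 < dt" and \<alpha>: "0 < \<alpha>" "\<alpha> < 1"
    and z: "z \<noteq> 0" "Re z \<le> 0"
  shows "\<exists>c>0. \<forall>\<xi>. norm \<xi> < 1 \<longrightarrow> c \<le> norm ((\<Sum>m. omega dt \<alpha> k i m * \<xi> ^ m) - z)"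
proof -
  define W where "W \<xi> = (\<Sum>m. omega dt \<alpha> k i m * \<xi> ^ m)" for \<xi>
  define c0 where "c0 = (2 powr \<alpha> - 1) / 24 / Gamma (1 - \<alpha>)"
  have G: "Gamma (1 - \<alpha>) > 0" using \<alpha> by (intro Gamma_real_pos) auto
  have "(2::real) powr 0 < 2 powr \<alpha>" using \<alpha> by (intro powr_less_mono) auto
  then have c0: "c0 > 0" using G by (simp add: c0_def)
  have om: "omega dt \<alpha> k i m = of_real (conv_weight \<alpha> k i m) / of_real (Gamma (1 - \<alpha>))" for m
    by (simp add: omega_eq[OF ki dt \<alpha>])
  have sm: "summable (\<lambda>m. norm (omega dt \<alpha> k i m))" by (rule omega_summable[OF ki dt \<alpha>])
  have Re: "c0 * (1 - Re \<xi>) \<le> Re (W \<xi>)" if \<xi>: "norm \<xi> < 1" for \<xi>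
  proof -
    have "summable (\<lambda>m. complex_of_real (conv_weight \<alpha> k i m) * \<xi> ^ m)"
    proof (rule summable_norm_cancel, rule summable_comparison_test'[OF summable_conv_weight[OF \<alpha>, of k i], of 0])
      show "norm (norm (complex_of_real (conv_weight \<alpha> k i n) * \<xi> ^ n)) \<le> \<bar>conv_weight \<alpha> k i n\<bar>" for n
        using \<xi> by (simp add: norm_mult norm_power mult_left_le power_le_one)
    qed
    then have "W \<xi> = (\<Sum>m. of_real (conv_weight \<alpha> k i m) * \<xi> ^ m) / of_real (Gamma (1 - \<alpha>))"
      unfolding W_def om by (subst suminf_divide[symmetric]) (auto simp: field_simps)
    then have "Re (W \<xi>) = Re (\<Sum>m. of_real (conv_weight \<alpha> k i m) * \<xi> ^ m) / Gamma (1 - \<alpha>)"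
      by (simp only: Re_divide_of_real)
    then show ?thesis
      using Re_conv_weight_ge[OF \<alpha> \<xi>, of k i] G by (simp add: c0_def field_simps)
  qed
  have "uniform_limit (cball 0 1) (\<lambda>n \<xi>. \<Sum>m<n. omega dt \<alpha> k i m * \<xi> ^ m) W sequentially"
    unfolding W_def[abs_def] using sm
    by (intro Weierstrass_m_test) (auto simp: norm_mult norm_power mult_left_le power_le_one)
  then have cont: "continuous_on (cball 0 1) W"
    by (rule uniform_limit_theorem[rotated]) (auto intro!: always_eventually continuous_intros)
  have W1: "W 1 = 0"
  proof -
    have "(\<lambda>m. complex_of_real (conv_weight \<alpha> k i m) / of_real (Gamma (1 - \<alpha>))) sums (of_real 0 / of_real (Gamma (1 - \<alpha>)))"
      by (intro sums_divide sums_of_real conv_weight_sums_0 \<alpha>)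
    then show ?thesis unfolding W_def om by (simp add: sums_iff)
  qed
  obtain \<delta> where \<delta>: "\<delta> > 0" "\<And>\<xi>. norm \<xi> \<le> 1 \<Longrightarrow> norm (\<xi> - 1) < \<delta> \<Longrightarrow> norm (W \<xi>) < norm z / 2"
  proof -
    have "\<exists>d>0. \<forall>x'\<in>cball 0 1. dist x' 1 < d \<longrightarrow> dist (W x') (W 1) < norm z / 2"
      using cont[unfolded continuous_on_iff, rule_format, of 1 "norm z / 2"] z by simp
    then show ?thesis using that by (auto simp: dist_norm W1)
  qed
  \<comment> \<open>The second entry comes from |\<xi> - 1|^2 \<le> 2 (1 - Re \<xi>) on the disc, so
    that 1 - Re \<xi> is at least \<delta>^2 / 2 outside the neighbourhood.\<close>
  define c where "c = min (norm z / 2) (c0 * (\<delta>\<^sup>2 / 2))"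
  have "c \<le> norm (W \<xi> - z)" if \<xi>: "norm \<xi> < 1" for \<xi>
  proof (cases "norm (\<xi> - 1) < \<delta>")
    case True
    then have "norm (W \<xi>) < norm z / 2" using \<delta> \<xi> by auto
    then have "norm z / 2 \<le> norm (W \<xi> - z)" using norm_triangle_ineq2[of z "W \<xi>"] by (simp add: norm_minus_commute)
    then show ?thesis by (simp add: c_def)
  next
    case False
    have "\<delta>\<^sup>2 \<le> (norm (\<xi> - 1))\<^sup>2" using False \<delta> by (intro power_mono) auto
    also have "\<dots> = (norm \<xi>)\<^sup>2 + 1 - 2 * Re \<xi>" by (simp add: cmod_power2 power2_diff)
    also have "\<dots> \<le> 2 * (1 - Re \<xi>)" using Re_sq_bounds(2)[of \<xi>] \<xi> by simp
    finally have "c0 * (\<delta>\<^sup>2 / 2) \<le> c0 * (1 - Re \<xi>)" using c0 by (intro mult_left_mono) auto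
    also have "\<dots> \<le> Re (W \<xi>)" by (rule Re[OF \<xi>])
    also have "\<dots> \<le> Re (W \<xi> - z)" using z by simp
    also have "\<dots> \<le> norm (W \<xi> - z)" by (rule complex_Re_le_cmod)
    finally show ?thesis by (simp add: c_def)
  qed
  moreover have "c > 0" using z c0 \<delta> by (simp add: c_def)
  ultimately show ?thesis unfolding W_def by blast
qed

lemma causal_recursion_unique_solution:
  fixes F :: "(nat \<Rightarrow> 'a) \<Rightarrow> nat \<Rightarrow> 'a"
  assumes F: "\<And>u v n. (\<And>j. j < n \<Longrightarrow> u j = v j) \<Longrightarrow> F u n = F v n"
  shows "\<exists>!u. \<forall>n. u n = F u n"
proof -
  have "\<exists>u. \<forall>n. u n = F u n"
    by (rule dependent_wf_choice[of "{(m, n). m < n}" "\<lambda>u n r. r = F u n"])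
      (auto simp: wf_less intro: F arg_cong)
  moreover have "u = v" if "\<forall>n. u n = F u n" "\<forall>n. v n = F v n" for u v
  proof
    show "u n = v n" for n
    proof (induction n rule: less_induct)
      case (less n)
      then have "F u n = F v n" by (rule F)
      then show ?case using that by metis
    qed
  qed
  ultimately show ?thesis by blast
qed

text \<open>In the equation at n \<ge> k the starting weights act on j < k \<le> n, so the unknown
  \<open>u n\<close> has the single factor z - omega_0, and solving for it gives a strict
  recursion.\<close>

lemma solves_unique:
  assumes "omega dt \<alpha> k i 0 \<noteq> z"
  shows "\<exists>!u. solves dt \<alpha> k i z s u"
proof -
  define F where "F u n = (if n < k then s n else
    ((\<Sum>j<k. wst dt \<alpha> k i n j * u j) + (\<Sum>j<n. omega dt \<alpha> k i (n - j) * u j)) / (z - omega dt \<alpha> k i 0))" for u n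
  have "solves dt \<alpha> k i z s u \<longleftrightarrow> (\<forall>n. u n = F u n)" for u
  proof -
    have "(\<Sum>j<k. wst dt \<alpha> k i n j * u j) + (\<Sum>j\<le>n. omega dt \<alpha> k i (n - j) * u j) = z * u n \<longleftrightarrow> u n = F u n"
      if "n \<ge> k" for n
      using that assms by (auto simp: F_def lessThan_Suc_atMost[symmetric] field_simps)
    then show ?thesis unfolding solves_def by (auto simp: F_def not_less)
  qed
  moreover have "\<exists>!u. \<forall>n. u n = F u n"
  proof (rule causal_recursion_unique_solution)
    fix u v :: "nat \<Rightarrow> complex" and n assume "\<And>j. j < n \<Longrightarrow> u j = v j"
    then show "F u n = F v n" by (auto simp: F_def intro!: sum.cong arg_cong2[of _ _ _ _ "(+)"] arg_cong2[of _ _ _ _ "(/)"])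
  qed
  ultimately show ?thesis by simp
qed

theorem theorem3p11:
  fixes \<alpha> dt :: real and k i :: nat
  assumes "0 < \<alpha>" and "\<alpha> < 1" and "0 < dt"
    and "(k, i) \<in> {(1, 1), (2, 1), (2, 2)}"
  shows "{z::complex. z \<noteq> 0 \<and> \<bar>Arg (- z)\<bar> \<le> pi / 2} \<subseteq> stab_region dt \<alpha> k i"
proof
  note ki = assms(4) assms(3) assms(1,2)
  fix z :: complex assume "z \<in> {z. z \<noteq> 0 \<and> \<bar>Arg (- z)\<bar> \<le> pi / 2}"
  \<comment> \<open>The sector is the closed left half-plane without 0.\<close>
  then have z: "z \<noteq> 0" "Re z \<le> 0"
    using Arg_Re_nonneg[of "- z"] by auto
  \<comment> \<open>Moving z u_n to the left changes only the weight at index 0, so the symbol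
    becomes that of \<open>omega\<close> minus z.\<close>
  define f where "f m = omega dt \<alpha> k i m - (if m = 0 then z else 0)" for m
  obtain c where c: "c > 0" "\<And>\<xi>. norm \<xi> < 1 \<Longrightarrow> c \<le> norm ((\<Sum>m. omega dt \<alpha> k i m * \<xi> ^ m) - z)"
    using symbol_lower_bound[OF ki z] by blast
  have f_sum: "summable (\<lambda>m. norm (f m))"
    using omega_summable[OF ki] by (subst summable_Suc_iff[symmetric]) (auto simp: f_def summable_Suc_iff[of "\<lambda>m. norm (omega dt \<alpha> k i m)"])
  have f_low: "c \<le> norm (\<Sum>m. f m * \<xi> ^ m)" if \<xi>: "norm \<xi> < 1" for \<xi>
  proof -
    have "summable (\<lambda>m. omega dt \<alpha> k i m * \<xi> ^ m)"
    proof (rule summable_norm_cancel, rule summable_comparison_test'[OF omega_summable[OF ki], of 0])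
      show "norm (norm (omega dt \<alpha> k i n * \<xi> ^ n)) \<le> norm (omega dt \<alpha> k i n)" for n
        using \<xi> by (simp add: norm_mult norm_power mult_left_le power_le_one)
    qed
    from sums_diff[OF summable_sums[OF this] sums_single[of 0 "\<lambda>m. z * \<xi> ^ m"]]
    have "(\<lambda>m. f m * \<xi> ^ m) sums ((\<Sum>m. omega dt \<alpha> k i m * \<xi> ^ m) - z)"
      by (simp add: f_def left_diff_distrib if_distrib[of "\<lambda>x. x * _"] cong: if_cong)
    then show ?thesis using c(2)[OF \<xi>] by (simp add: sums_iff)
  qed
  \<comment> \<open>At \<xi> = 0 the symbol bound reads c \<le> |omega_0 - z|, so the recursion is
    solvable.\<close>
  have "omega dt \<alpha> k i 0 \<noteq> z"
    using c(1) c(2)[of 0] by auto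
  moreover have "u \<longlonglongrightarrow> 0" if u: "solves dt \<alpha> k i z s u" for s u
  proof (rule convolution_solution_tendsto_0[OF f_sum c(1) f_low])
    \<comment> \<open>The right-hand side is defined as the convolution itself. For n \<ge> k it
      equals minus the contribution of the k starting values, a finite combination of null
      sequences; its earlier entries do not affect the limit.\<close>
    let ?g = "\<lambda>n. \<Sum>j\<le>n. f (n - j) * u j"
    show "\<And>n. ?g n = ?g n" ..
    have "(\<lambda>n. - (\<Sum>j<k. wst dt \<alpha> k i n j * u j)) \<longlonglongrightarrow> - (\<Sum>j<k. 0 * u j)"
      by (intro tendsto_minus tendsto_sum tendsto_mult tendsto_const wst_tendsto_0 ki)
    moreover have "- (\<Sum>j<k. wst dt \<alpha> k i n j * u j) = ?g n" if "n \<ge> k" for n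
    proof -
      have "?g n = (\<Sum>j\<le>n. omega dt \<alpha> k i (n - j) * u j) - (\<Sum>j\<le>n. if j = n then z * u j else 0)"
        unfolding sum_subtractf[symmetric] by (intro sum.cong) (auto simp: f_def left_diff_distrib)
      also have "\<dots> = (\<Sum>j\<le>n. omega dt \<alpha> k i (n - j) * u j) - z * u n" by (simp add: sum.delta)
      finally have g: "?g n = (\<Sum>j\<le>n. omega dt \<alpha> k i (n - j) * u j) - z * u n" .
      have "(\<Sum>j<k. wst dt \<alpha> k i n j * u j) + (\<Sum>j\<le>n. omega dt \<alpha> k i (n - j) * u j) = z * u n"
        using u that unfolding solves_def by blast
      then show ?thesis unfolding g by (metis add_diff_cancel_left' minus_diff_eq diff_diff_eq2 add_diff_cancel_right')
    qed
    then have "eventually (\<lambda>n. - (\<Sum>j<k. wst dt \<alpha> k i n j * u j) = ?g n) sequentially"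
      unfolding eventually_sequentially by blast
    ultimately have "?g \<longlonglongrightarrow> - (\<Sum>j<k. 0 * u j)" by (rule Lim_transform_eventually)
    then show "?g \<longlonglongrightarrow> 0" by simp
  qed auto
  ultimately show "z \<in> stab_region dt \<alpha> k i"
    unfolding stab_region_def using solves_unique by blast
qed

end
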